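(* Let $\alpha\in[0,1]$, $\delta\in(-1,\infty)$, and let $(G(t))_{t\ge 0}$ be the random graph process with parameters $\alpha,\delta$ described in the context. Let $$A=\frac{(\alpha+1)^2+\delta\alpha}{(\alpha+1)[2(\alpha+1)+\delta]}.$$ Then the expected value of the global clustering coefficient $\mathcal{C}_2(t)$ of $G(t)$ satisfies, as $t\to\infty$, $$\mathbb{E}[\mathcal{C}_2(t)]=\begin{cases}\Theta(1), & \text{if } A<\frac12,\\ \Theta\big((\ln t)^{-1}\big), & \text{if } A=\frac12,\\ \Theta\big(t^{1-2A}\big), & \text{if } A>\frac12.\end{cases}$$
   Context: The model: $(G(t))_{t\in\mathbb{N}_0}$ is a random process of undirected simple graphs with vertex set $V_t=\{v_1,\dots,v_{t+2}\}$ and edge set $E_t$. $G(0)$ consists of two vertices $v_1,v_2$ joined by an edge. Given $G(0),\dots,G(t)$, the graph $G(t+1)$ is obtained from $G(t)$ by adding a new vertex $v_{t+3}$ and, with a choice between the two options made independently of the past: - with probability $1-\alpha$, joining $v_{t+3}$ by an edge to exactly one vertex of $V_t$, where $u\in V_t$ is chosen with (conditional) probability $\frac{d_t(u)+\delta}{2|E_t|+\delta(t+2)}$, $d_t(u)$ being the degree of $u$ in $G(t)$; - with probability $\alpha$, choosing an edge $\{u,v\}\in E_t$ uniformly at random and joining $v_{t+3}$ by edges to both $u$ and $v$ (so a triangle is created). Global clustering coefficient: $\mathcal{C}_2(t)=\frac{3T_t}{C_t}$, where $T_t$ is the number of triangles in $G(t)$ (sets of three mutually adjacent vertices) and $C_t=\sum_{i=1}^{|V_t|}\binom{d_t(v_i)}{2}$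 is the number of connected triples in $G(t)$. Notation: $x_t=\Theta(y_t)$ means there are constants $C,c>0$ with $c\,y_t\le x_t\le C\,y_t$ for all large enough $t$.
   Formalization: The value α = 0 is excluded (0 < α ≤ 1 is assumed): for α = 0 every G(t) is almost surely a tree, so the expected clustering coefficient is 0 for all t and none of the three Θ-statements can hold. *)

theory Defs
  imports "HOL-Probability.Probability" "HOL-Library.Landau_Symbols"
begin

text \<open>A graph is a pair of a vertex set and an edge set, an edge being the two-element set of its
  endpoints. The vertex \<open>v\<^sub>i\<close> of the process is the number \<open>i\<close>.\<close>

type_synonym graph = "nat set \<times> nat set set"

abbreviation verts :: "graph \<Rightarrow> nat set" where "verts \<equiv> fst"
abbreviation edges :: "graph \<Rightarrow> nat set set" where "edges \<equiv> snd"

definition degree :: "graph \<Rightarrow> nat \<Rightarrow> nat" where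
  "degree g u = card {e \<in> edges g. u \<in> e}"

definition num_triangles :: "graph \<Rightarrow> nat" where
  "num_triangles g =
     card {S. S \<subseteq> verts g \<and> card S = 3 \<and> (\<forall>u\<in>S. \<forall>v\<in>S. u \<noteq> v \<longrightarrow> {u, v} \<in> edges g)}"

definition num_triples :: "graph \<Rightarrow> nat" where
  "num_triples g = (\<Sum>v\<in>verts g. degree g v choose 2)"

text \<open>If there is no connected triple (as in \<open>G(0)\<close>), the value is 0, by division by zero.\<close>

definition global_clustering :: "graph \<Rightarrow> real" where
  "global_clustering g = 3 * real (num_triangles g) / real (num_triples g)"

definition initial_graph :: graph where
  "initial_graph = ({1, 2}, {{1, 2}})"

definition join_vertex :: "nat \<Rightarrow> graph \<Rightarrow> nat \<Rightarrow> graph" where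
  "join_vertex w g u = (insert w (verts g), insert {w, u} (edges g))"

definition join_edge :: "nat \<Rightarrow> graph \<Rightarrow> nat set \<Rightarrow> graph" where
  "join_edge w g e = (insert w (verts g), edges g \<union> {{w, u} | u. u \<in> e})"

definition attach_prob :: "real \<Rightarrow> nat \<Rightarrow> graph \<Rightarrow> nat \<Rightarrow> real" where
  "attach_prob \<delta> t g u =
     (real (degree g u) + \<delta>) / (2 * real (card (edges g)) + \<delta> * (real t + 2))"

text \<open>The conditional probability that \<open>G(t+1) = h\<close> given the past with \<open>G(t) = g\<close>. That the weights
  \<open>\<alpha>\<close> and \<open>1 - \<alpha>\<close> do not involve the past expresses the independence of the choice between
  the two options.\<close>

definition step_prob :: "real \<Rightarrow> real \<Rightarrow> nat \<Rightarrow> graph \<Rightarrow> graph \<Rightarrow> real" where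
  "step_prob \<alpha> \<delta> t g h =
     (1 - \<alpha>) * (\<Sum>u\<in>verts g. attach_prob \<delta> t g u * of_bool (h = join_vertex (t + 3) g u)) +
     \<alpha> * (\<Sum>e\<in>edges g. 1 / real (card (edges g)) * of_bool (h = join_edge (t + 3) g e))"

text \<open>For \<open>\<alpha> = 0\<close> the graphs are almost surely trees, so that the clustering coefficient vanishes and
  no lower bound by a positive function can hold; asymptotic statements about its exact order need
  \<open>\<alpha> > 0\<close>.\<close>

locale random_graph_process = prob_space M
  for M :: "'a measure" +
  fixes G :: "nat \<Rightarrow> 'a \<Rightarrow> graph" and \<alpha> \<delta> :: real
  assumes measurable_G: "\<And>t. random_variable (count_space UNIV) (G t)"
    and initial: "AE \<omega> in M. G 0 \<omega> = initial_graph"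
    and step: "\<And>t g h. \<P>(\<omega> in M. \<forall>s\<le>t. G s \<omega> = g s) > 0 \<Longrightarrow>
      \<P>(\<omega> in M. G (Suc t) \<omega> = h \<bar> \<forall>s\<le>t. G s \<omega> = g s) = step_prob \<alpha> \<delta> t (g t) h"

end

theory Submission
  imports Defs
begin

text \<open>
  Let \<open>E\<close>, \<open>T\<close>, \<open>C\<close> be the numbers of edges, triangles and connected triples of \<open>G(t)\<close>. A new vertex
  closes a triangle exactly when it is joined to both ends of an edge, so \<open>T\<close> counts the steps of the
  second kind: \<open>T \<le> t\<close>, the mean of \<open>T\<close> is \<open>\<alpha> t\<close>, and \<open>E = t + 1 + T\<close>. Each step adds to \<open>C\<close> the degrees
  of the chosen vertices, and one more triple if there are two of them. Averaging the degrees against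
  the attachment rule gives, with \<open>D = 2 E + \<delta> (t + 2)\<close>, a conditional mean increment of \<open>C\<close> equal to
  \<open>C (2 (1 - \<alpha>) / D + 2 \<alpha> / E)\<close> plus a term that is bounded and at least \<open>3 \<alpha>\<close>
  (\<open>mean_gain_bounds\<close>). As \<open>E\<close> is close to \<open>(1 + \<alpha>) t\<close>, the rate is close to \<open>2 A / t\<close>. So \<open>C\<close> should
  have order \<open>t\<close>, \<open>t ln t\<close> or \<open>t\<^sup>2\<^sup>A\<close>, according to the three cases, and \<open>3 T / C\<close> the order that is
  claimed.

  The rate is random through \<open>E\<close>. Rather than controlling the fluctuations of \<open>E\<close>, the proof compares \<open>C\<close>
  with \<open>W = E\<^sup>a D\<^sup>b\<close>, where \<open>a = 2 \<alpha> / (1 + \<alpha>)\<close> and \<open>b = 2 (1 - \<alpha>) / (2 (1 + \<alpha>) + \<delta>)\<close> are chosen so that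
  the conditional mean increment of \<open>ln W\<close> is the same random rate, up to an error of order \<open>1 / t\<^sup>2\<close>.
  Since \<open>E\<close> and \<open>D\<close> lie between constant multiples of \<open>t + 1\<close> and \<open>a + b = 2 A\<close>, the scale \<open>W\<close> always lies
  between constant multiples of \<open>(t + 1)\<^sup>2\<^sup>A\<close> (\<open>normalisation_bounds\<close>). Two drift inequalities follow: for
  \<open>C / W\<close> (\<open>triples_drift\<close>) and for \<open>W / C\<close> (\<open>inverse_triples_drift\<close>). In the second one the quadratic
  error is summable because \<open>C \<ge> t\<close> and all degrees are at most \<open>3 \<surd>C\<close>.

  For the lower bound on the mean of \<open>3 T / C\<close>, the drift of \<open>C / W\<close> bounds the mean of \<open>C\<close> above, and an
  inequality of Cauchy and Schwarz type turns this into a lower bound \<open>3 \<alpha>\<^sup>2 t / E[C]\<close>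
  (\<open>mean_clustering_lower\<close>). For the upper bound, \<open>T \<le> t \<le> C\<close> suffices if \<open>A < 1/2\<close>. If \<open>A > 1/2\<close>, the
  mean of \<open>W / C\<close> stays bounded and hence the mean of \<open>1 / C\<close> has order at most \<open>t\<^sup>-\<^sup>2\<^sup>A\<close>. If \<open>A = 1/2\<close>,
  the mean \<open>y\<close> of \<open>W / C\<close> has to decay like \<open>1 / ln t\<close>: the bounded part of the increment of \<open>C\<close> contributes a
  negative term, at most \<open>- c y\<^sup>2 / t\<close> by Jensen's inequality, and \<open>y' = - c y\<^sup>2 / t\<close> forces this decay
  (\<open>logistic_recursion_bound\<close>).
\<close>

section \<open>Counting edges, triangles and triples when a vertex is added\<close>

definition simple_graph :: "graph \<Rightarrow> bool" where
  "simple_graph g \<longleftrightarrow> finite (verts g) \<and> (\<forall>e\<in>edges g. e \<subseteq> verts g \<and> card e = 2)"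

lemma simple_graph_finite_edges: "simple_graph g \<Longrightarrow> finite (edges g)"
  by (rule finite_subset[of _ "Pow (verts g)"]) (auto simp: simple_graph_def)

text \<open>Both kinds of steps join a new vertex to a set \<open>N\<close> of old ones, a single vertex or the two ends of an
  edge; the counts below are computed once, for any \<open>N\<close>.\<close>

lemma join_vertex_eq_join_edge: "join_vertex w g u = join_edge w g {u}"
  by (auto simp: join_vertex_def join_edge_def)

text \<open>Double counting of the pairs of an edge and one of its ends. With \<open>f = 1\<close> it is the handshake lemma;
  with \<open>f\<close> the degree it relates the mean degree at the ends of a random edge to the sum of squared
  degrees.\<close>

lemma sum_degree_mult:
  fixes f :: "nat \<Rightarrow> real"
  assumes "simple_graph g"
  shows "(\<Sum>v\<in>verts g. real (degree g v) * f v) = (\<Sum>e\<in>edges g. \<Sum>v\<in>e. f v)"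
proof -
  have fin: "finite (verts g)" "finite (edges g)"
    using assms simple_graph_finite_edges by (auto simp: simple_graph_def)
  have "(\<Sum>v\<in>verts g. real (degree g v) * f v) = (\<Sum>v\<in>verts g. \<Sum>e\<in>edges g. if v \<in> e then f v else 0)"
    using fin by (intro sum.cong) (simp_all add: degree_def flip: sum.inter_filter)
  also have "\<dots> = (\<Sum>e\<in>edges g. \<Sum>v\<in>verts g. if v \<in> e then f v else 0)"
    by (rule sum.swap)
  also have "\<dots> = (\<Sum>e\<in>edges g. \<Sum>v\<in>e. f v)"
  proof (rule sum.cong[OF refl])
    fix e assume "e \<in> edges g"
    then have "{v \<in> verts g. v \<in> e} = e" using assms by (auto simp: simple_graph_def)
    then show "(\<Sum>v\<in>verts g. if v \<in> e then f v else 0) = (\<Sum>v\<in>e. f v)"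
      using fin by (simp flip: sum.inter_filter)
  qed
  finally show ?thesis .
qed

lemma sum_degree:
  assumes "simple_graph g"
  shows "(\<Sum>v\<in>verts g. real (degree g v)) = 2 * real (card (edges g))"
  using sum_degree_mult[OF assms, of "\<lambda>_. 1"] assms by (simp add: simple_graph_def)

lemma real_choose_two: "real (n choose 2) = real n * (real n - 1) / 2"
  by (induction n) (auto simp: numeral_2_eq_2 field_simps)

lemma sum_degree_square:
  assumes "simple_graph g"
  shows "(\<Sum>v\<in>verts g. (real (degree g v))\<^sup>2) = 2 * real (num_triples g) + 2 * real (card (edges g))"
proof -
  have "2 * real (num_triples g) = (\<Sum>v\<in>verts g. (real (degree g v))\<^sup>2 - real (degree g v))"
    unfolding num_triples_def
    by (simp add: real_choose_two sum_distrib_left power2_eq_square field_simps flip: sum_divide_distrib)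
  then show ?thesis
    using sum_degree[OF assms] by (simp add: sum_subtractf)
qed

text \<open>A vertex of degree \<open>d\<close> is the centre of \<open>d (d - 1) / 2\<close> triples.\<close>

lemma degree_bound:
  assumes "simple_graph g" "v \<in> verts g" "1 \<le> num_triples g"
  shows "real (degree g v) \<le> 3 * sqrt (real (num_triples g))"
proof -
  define d C where "d = real (degree g v)" and "C = real (num_triples g)"
  have "degree g v choose 2 \<le> num_triples g"
    unfolding num_triples_def using assms
    by (intro member_le_sum[of v "verts g" "\<lambda>v. degree g v choose 2"]) (auto simp: simple_graph_def)
  then have "real (degree g v choose 2) \<le> C" by (simp add: C_def)
  then have le: "d * (d - 1) \<le> 2 * C" by (simp add: real_choose_two d_def)
  have C: "1 \<le> C" "d \<ge> 0" using assms by (auto simp: C_def d_def)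
  have "2 * d \<le> 1 + d\<^sup>2" using sum_power2_ge_zero[of "d - 1" 0] by (simp add: power2_eq_square algebra_simps)
  then have "d\<^sup>2 \<le> 9 * C" using le C by (simp add: power2_eq_square algebra_simps)
  then have "d\<^sup>2 \<le> (3 * sqrt C)\<^sup>2" using C by (simp add: power_mult_distrib)
  then show ?thesis unfolding d_def C_def by (rule power2_le_imp_le) simp
qed

locale new_vertex =
  fixes g :: graph and w :: nat and N :: "nat set"
  assumes simple: "simple_graph g" and fresh: "w \<notin> verts g" and nbrs: "N \<subseteq> verts g"
begin

lemma finite_facts: "finite (verts g)" "finite (edges g)" "finite N"
  using simple simple_graph_finite_edges nbrs finite_subset by (auto simp: simple_graph_def)

lemma new_edges_image: "{{w, u} | u. u \<in> N} = (\<lambda>u. {w, u}) ` N"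
  by auto

lemma inj_new_edges: "inj_on (\<lambda>u. {w, u}) N"
  using fresh nbrs by (auto simp: inj_on_def doubleton_eq_iff)

lemma fresh_edges: "e \<in> edges g \<Longrightarrow> w \<notin> e"
  using simple fresh by (auto simp: simple_graph_def)

lemma simple_join: "simple_graph (join_edge w g N)"
proof -
  have "card {w, u} = 2" if "u \<in> N" for u
    using that fresh nbrs by (auto simp: card_insert_if)
  then show ?thesis
    using simple nbrs by (auto simp: simple_graph_def join_edge_def)
qed

lemma verts_join: "verts (join_edge w g N) = insert w (verts g)"
  by (simp add: join_edge_def)

lemma card_edges_join: "card (edges (join_edge w g N)) = card (edges g) + card N"
  unfolding join_edge_def snd_conv new_edges_image
  using finite_facts inj_new_edges fresh_edges
  by (subst card_Un_disjoint) (auto simp: card_image)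

lemma degree_join_new: "degree (join_edge w g N) w = card N"
proof -
  have "{e \<in> edges (join_edge w g N). w \<in> e} = (\<lambda>u. {w, u}) ` N"
    using fresh_edges by (auto simp: join_edge_def)
  then show ?thesis by (simp add: degree_def card_image inj_new_edges)
qed

lemma degree_join_old:
  assumes "v \<in> verts g"
  shows "degree (join_edge w g N) v = degree g v + of_bool (v \<in> N)"
proof -
  have "v \<noteq> w" using assms fresh by auto
  then have *: "{e \<in> edges (join_edge w g N). v \<in> e}
      = {e \<in> edges g. v \<in> e} \<union> (if v \<in> N then {{w, v}} else {})"
    by (auto simp: join_edge_def)
  have "{w, v} \<notin> edges g" using fresh_edges[of "{w, v}"] by auto
  then show ?thesis
    unfolding degree_def * using finite_facts by auto
qed

text \<open>Old triples survive; the new edge at \<open>v \<in> N\<close> forms one new triple centred at \<open>v\<close> with each old edge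
  there, and the new edges form triples centred at \<open>w\<close>.\<close>

lemma num_triples_join:
  "num_triples (join_edge w g N) = num_triples g + (\<Sum>v\<in>N. degree g v) + (card N choose 2)"
proof -
  have "num_triples (join_edge w g N)
      = (card N choose 2) + (\<Sum>v\<in>verts g. (degree g v + of_bool (v \<in> N)) choose 2)"
    unfolding num_triples_def verts_join
    using finite_facts fresh by (simp add: degree_join_new degree_join_old)
  also have "(\<Sum>v\<in>verts g. (degree g v + of_bool (v \<in> N)) choose 2)
      = (\<Sum>v\<in>verts g. (degree g v choose 2) + (if v \<in> N then degree g v else 0))"
    by (intro sum.cong) (auto simp: numeral_2_eq_2)
  also have "\<dots> = num_triples g + (\<Sum>v\<in>N. degree g v)"
  proof -
    have "{v \<in> verts g. v \<in> N} = N" using nbrs by auto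
    then show ?thesis
      using finite_facts by (simp add: sum.distrib num_triples_def flip: sum.inter_filter)
  qed
  finally show ?thesis by simp
qed

text \<open>A triangle through \<open>w\<close> consists of \<open>w\<close> and an old edge whose ends are both neighbours of \<open>w\<close>.\<close>

lemma num_triangles_join:
  "num_triangles (join_edge w g N) = num_triangles g + card {e \<in> edges g. e \<subseteq> N}"
proof -
  define tri where "tri h = {S. S \<subseteq> verts h \<and> card S = 3 \<and> (\<forall>u\<in>S. \<forall>v\<in>S. u \<noteq> v \<longrightarrow> {u, v} \<in> edges h)}"
    for h :: graph
  let ?h = "join_edge w g N"
  have adj_old: "{u, v} \<in> edges ?h \<longleftrightarrow> {u, v} \<in> edges g" if "u \<noteq> w" "v \<noteq> w" for u v
    using that by (auto simp: join_edge_def doubleton_eq_iff)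
  have adj_new: "{w, v} \<in> edges ?h \<longleftrightarrow> v \<in> N" if "v \<noteq> w" for v
    using that fresh_edges[of "{w, v}"] by (auto simp: join_edge_def doubleton_eq_iff)
  have old: "{S \<in> tri ?h. w \<notin> S} = tri g"
    using fresh adj_old by (auto simp: tri_def verts_join subset_iff) metis+
  have new: "{S \<in> tri ?h. w \<in> S} = insert w ` {e \<in> edges g. e \<subseteq> N}"
  proof (intro equalityI subsetI)
    fix S assume S: "S \<in> {S \<in> tri ?h. w \<in> S}"
    define e where "e = S - {w}"
    have Se: "S = insert w e" "w \<notin> e" using S by (auto simp: e_def)
    have "finite S" using S by (auto simp: tri_def intro!: card_ge_0_finite)
    then have "card e = 2" using S Se by (auto simp: tri_def)
    then obtain u v where uv: "e = {u, v}" "u \<noteq> v" by (auto simp: card_2_iff)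
    have "u \<noteq> w" "v \<noteq> w" using Se uv by auto
    have adj: "\<forall>x\<in>S. \<forall>y\<in>S. x \<noteq> y \<longrightarrow> {x, y} \<in> edges ?h" using S by (simp add: tri_def)
    have "{u, v} \<in> edges ?h" "{w, u} \<in> edges ?h" "{w, v} \<in> edges ?h"
      using adj Se uv \<open>u \<noteq> w\<close> \<open>v \<noteq> w\<close> by auto
    then have "e \<in> edges g" "e \<subseteq> N"
      using adj_old adj_new \<open>u \<noteq> w\<close> \<open>v \<noteq> w\<close> uv by auto
    then show "S \<in> insert w ` {e \<in> edges g. e \<subseteq> N}" using Se by blast
  next
    fix S assume "S \<in> insert w ` {e \<in> edges g. e \<subseteq> N}"
    then obtain e where e: "S = insert w e" "e \<in> edges g" "e \<subseteq> N" by auto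
    then have ce: "card e = 2" "e \<subseteq> verts g" using simple by (auto simp: simple_graph_def)
    then obtain u v where uv: "e = {u, v}" "u \<noteq> v" by (auto simp: card_2_iff)
    have w: "w \<notin> e" using e fresh_edges by blast
    have "card S = 3" using w e uv by auto
    moreover have "{x, y} \<in> edges ?h" if xy: "x \<in> S" "y \<in> S" "x \<noteq> y" for x y
    proof (cases "x = w \<or> y = w")
      case True
      then show ?thesis using xy e adj_new by (metis insert_commute insert_iff subsetD)
    next
      case False
      then have "{x, y} = e" using xy e uv by auto
      then show ?thesis using e by (simp add: join_edge_def)
    qed
    ultimately show "S \<in> {S \<in> tri ?h. w \<in> S}"
      using e ce by (auto simp: tri_def verts_join)
  qed
  have fin: "finite (tri h)" if "finite (verts h)" for h
    using that by (auto simp: tri_def intro: finite_subset[of _ "Pow (verts h)"])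
  have "tri ?h = tri g \<union> insert w ` {e \<in> edges g. e \<subseteq> N}"
    using old new by blast
  moreover have "tri g \<inter> insert w ` {e \<in> edges g. e \<subseteq> N} = {}"
    using fresh by (auto simp: tri_def)
  moreover have "inj_on (insert w) {e \<in> edges g. e \<subseteq> N}"
    using fresh_edges by (auto simp: inj_on_def) (metis insert_ident)+
  ultimately have "card (tri ?h) = card (tri g) + card {e \<in> edges g. e \<subseteq> N}"
    using finite_facts fin[of g] by (simp add: card_Un_disjoint card_image)
  then show ?thesis by (simp add: tri_def num_triangles_def)
qed

end

section \<open>Reachable graphs\<close>

text \<open>A set of graphs that contains the support of \<open>G(t)\<close> for all parameters, is finite at each time and
  carries the deterministic invariants of the process.\<close>

inductive reachable :: "nat \<Rightarrow> graph \<Rightarrow> bool" where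
  start: "reachable 0 initial_graph"
| attach_to_vertex: "reachable t g \<Longrightarrow> u \<in> verts g \<Longrightarrow> reachable (Suc t) (join_edge (t + 3) g {u})"
| attach_to_edge: "reachable t g \<Longrightarrow> e \<in> edges g \<Longrightarrow> reachable (Suc t) (join_edge (t + 3) g e)"

lemma simple_initial: "simple_graph initial_graph"
  by (auto simp: simple_graph_def initial_graph_def)

lemma counts_initial:
  "card (edges initial_graph) = 1" "num_triangles initial_graph = 0" "num_triples initial_graph = 0"
  "degree initial_graph 1 = 1" "degree initial_graph 2 = 1"
proof -
  show 1: "card (edges initial_graph) = 1" by (simp add: initial_graph_def)
  have "{e. e = {Suc 0, 2} \<and> Suc 0 \<in> e} = {{Suc 0, 2}}" "{e. e = {Suc 0, 2} \<and> 2 \<in> e} = {{Suc 0, 2}}"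
    by auto
  then show 2: "degree initial_graph 1 = 1" "degree initial_graph 2 = 1"
    by (simp_all add: degree_def initial_graph_def)
  show "num_triples initial_graph = 0"
    unfolding num_triples_def initial_graph_def fst_conv
    using 2 by (simp add: initial_graph_def)
  have "card S \<noteq> 3" if "S \<subseteq> {1, 2}" for S :: "nat set"
    using card_mono[OF _ that] by auto
  then show "num_triangles initial_graph = 0"
    by (auto simp: num_triangles_def initial_graph_def)
qed

lemma reachable_simple_verts:
  "reachable t g \<Longrightarrow> simple_graph g \<and> verts g = {1..t + 2}"
proof (induction rule: reachable.induct)
  case start
  show ?case using simple_initial by (auto simp: initial_graph_def)
next
  case (attach_to_vertex t g u)
  then interpret new_vertex g "t + 3" "{u}" by unfold_locales auto
  show ?case using attach_to_vertex simple_join by (auto simp: verts_join)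
next
  case (attach_to_edge t g e)
  then interpret new_vertex g "t + 3" e by unfold_locales (auto simp: simple_graph_def)
  show ?case using attach_to_edge simple_join by (auto simp: verts_join)
qed

lemma new_vertex_reachable:
  assumes "reachable t g"
  shows "u \<in> verts g \<Longrightarrow> new_vertex g (t + 3) {u}" "e \<in> edges g \<Longrightarrow> new_vertex g (t + 3) e"
  using reachable_simple_verts[OF assms] by (unfold_locales; auto simp: simple_graph_def)+

lemma edges_inside_edge:
  assumes "simple_graph g"
  shows "{e \<in> edges g. e \<subseteq> {u}} = {}" "e \<in> edges g \<Longrightarrow> {e' \<in> edges g. e' \<subseteq> e} = {e}"
proof -
  have "\<not> e \<subseteq> {u}" if "e \<in> edges g" for e
    using card_mono[of "{u}" e] that assms by (auto simp: simple_graph_def)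
  then show "{e \<in> edges g. e \<subseteq> {u}} = {}" by auto
  assume e: "e \<in> edges g"
  then have fin: "finite e" using assms by (auto simp: simple_graph_def intro: finite_subset)
  have "e' = e" if "e' \<in> edges g" "e' \<subseteq> e" for e'
    using card_subset_eq[OF fin that(2)] that e assms by (simp add: simple_graph_def)
  then show "{e' \<in> edges g. e' \<subseteq> e} = {e}" using e by auto
qed

lemma vertex_attachment_counts:
  assumes "reachable t g" "u \<in> verts g"
  defines "h \<equiv> join_edge (t + 3) g {u}"
  shows "card (edges h) = card (edges g) + 1" "num_triangles h = num_triangles g"
    "num_triples h = num_triples g + degree g u"
proof -
  interpret new_vertex g "t + 3" "{u}" using new_vertex_reachable assms by blast
  show "card (edges h) = card (edges g) + 1" "num_triangles h = num_triangles g"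
    "num_triples h = num_triples g + degree g u"
    using edges_inside_edge[OF simple]
    by (simp_all add: h_def card_edges_join num_triangles_join num_triples_join)
qed

lemma edge_attachment_counts:
  assumes "reachable t g" "e \<in> edges g"
  defines "h \<equiv> join_edge (t + 3) g e"
  shows "card (edges h) = card (edges g) + 2" "num_triangles h = num_triangles g + 1"
    "num_triples h = num_triples g + (\<Sum>v\<in>e. degree g v) + 1"
proof -
  interpret new_vertex g "t + 3" e using new_vertex_reachable assms by blast
  have "card e = 2" using simple assms by (auto simp: simple_graph_def)
  then show "card (edges h) = card (edges g) + 2" "num_triangles h = num_triangles g + 1"
    "num_triples h = num_triples g + (\<Sum>v\<in>e. degree g v) + 1"
    using edges_inside_edge[OF simple] assms
    by (simp_all add: h_def card_edges_join num_triangles_join num_triples_join)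
qed

text \<open>Positive degrees are what makes the attachment weights \<open>d + \<delta>\<close> positive for every \<open>\<delta> > -1\<close>.\<close>

lemma degree_pos_reachable: "reachable t g \<Longrightarrow> v \<in> verts g \<Longrightarrow> 1 \<le> degree g v"
proof (induction arbitrary: v rule: reachable.induct)
  case start
  then show ?case using counts_initial by (auto simp: initial_graph_def)
next
  case (attach_to_vertex t g u)
  then interpret new_vertex g "t + 3" "{u}" using new_vertex_reachable by blast
  show ?case using attach_to_vertex degree_join_new
    by (cases "v = t + 3") (auto simp: verts_join degree_join_old trans_le_add1)
next
  case (attach_to_edge t g e)
  then interpret new_vertex g "t + 3" e using new_vertex_reachable by blast
  have "card e = 2" using simple attach_to_edge by (auto simp: simple_graph_def)
  then show ?case using attach_to_edge degree_join_new
    by (cases "v = t + 3") (auto simp: verts_join degree_join_old trans_le_add1)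
qed

text \<open>Every step creates at least one triple because all degrees are positive; a step on an edge adds one
  more edge than a step on a vertex, and one triangle.\<close>

lemma reachable_counts:
  "reachable t g \<Longrightarrow> card (edges g) = t + 1 + num_triangles g \<and> num_triangles g \<le> t \<and> t \<le> num_triples g"
proof (induction rule: reachable.induct)
  case start
  then show ?case using counts_initial by auto
next
  case (attach_to_vertex t g u)
  then show ?case
    using vertex_attachment_counts[of t g u] degree_pos_reachable[of t g u] by simp
next
  case (attach_to_edge t g e)
  then show ?case
    using edge_attachment_counts[of t g e] by simp
qed

lemma finite_reachable: "finite {g. reachable t g}"
proof (induction t)
  case 0
  have "{g. reachable 0 g} = {initial_graph}" by (auto elim: reachable.cases intro: reachable.start)
  then show ?case by simp
next
  case (Suc t)
  have "{g. reachable (Suc t) g} \<subseteq> (\<Union>g\<in>{g. reachable t g}.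
      (\<lambda>u. join_edge (t + 3) g {u}) ` verts g \<union> join_edge (t + 3) g ` edges g)"
    by (auto elim!: reachable.cases[of "Suc t"])
  moreover have "finite \<dots>"
    using Suc reachable_simple_verts simple_graph_finite_edges by (intro finite_UN_I) auto
  ultimately show ?case by (rule finite_subset)
qed

text \<open>The conditional mean of \<open>f (G(t+1))\<close> given \<open>G(t) = g\<close>.\<close>

definition step_mean :: "real \<Rightarrow> real \<Rightarrow> nat \<Rightarrow> (graph \<Rightarrow> real) \<Rightarrow> graph \<Rightarrow> real" where
  "step_mean \<alpha> \<delta> t f g =
     (1 - \<alpha>) * (\<Sum>u\<in>verts g. attach_prob \<delta> t g u * f (join_edge (t + 3) g {u})) +
     \<alpha> * (\<Sum>e\<in>edges g. 1 / real (card (edges g)) * f (join_edge (t + 3) g e))"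

lemma sum_step_prob:
  assumes "reachable t g"
  shows "(\<Sum>h | reachable (Suc t) h. step_prob \<alpha> \<delta> t g h * f h) = step_mean \<alpha> \<delta> t f g"
proof -
  let ?R = "{h. reachable (Suc t) h}"
  have pick: "(\<Sum>h\<in>?R. \<Sum>x\<in>X. c x * of_bool (h = k x) * f h) = (\<Sum>x\<in>X. c x * f (k x))"
    if "\<And>x. x \<in> X \<Longrightarrow> reachable (Suc t) (k x)" for X :: "'b set" and c :: "'b \<Rightarrow> real" and k
  proof -
    have "(\<Sum>h\<in>?R. \<Sum>x\<in>X. c x * of_bool (h = k x) * f h)
        = (\<Sum>x\<in>X. \<Sum>h\<in>?R. c x * of_bool (h = k x) * f h)"
      by (rule sum.swap)
    also have "\<dots> = (\<Sum>x\<in>X. \<Sum>h\<in>?R. if h = k x then c x * f (k x) else 0)"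
      by (intro sum.cong) auto
    also have "\<dots> = (\<Sum>x\<in>X. c x * f (k x))"
      using that finite_reachable by (intro sum.cong) (auto simp: sum.delta)
    finally show ?thesis .
  qed
  have "(\<Sum>h\<in>?R. step_prob \<alpha> \<delta> t g h * f h) =
      (1 - \<alpha>) * (\<Sum>h\<in>?R. \<Sum>u\<in>verts g.
        attach_prob \<delta> t g u * of_bool (h = join_edge (t + 3) g {u}) * f h) +
      \<alpha> * (\<Sum>h\<in>?R. \<Sum>e\<in>edges g.
        1 / real (card (edges g)) * of_bool (h = join_edge (t + 3) g e) * f h)"
    unfolding step_prob_def join_vertex_eq_join_edge
    by (simp only: distrib_right sum.distrib mult.assoc sum_distrib_right sum_distrib_left)
  also have "\<dots> = step_mean \<alpha> \<delta> t f g"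
    unfolding step_mean_def using assms by (simp only: pick reachable.intros)
  finally show ?thesis .
qed

section \<open>One-step averages\<close>

locale attachment_parameters =
  fixes \<alpha> \<delta> :: real
  assumes alpha_pos: "0 < \<alpha>" and alpha_le_1: "\<alpha> \<le> 1" and delta_gt: "-1 < \<delta>"
begin

definition total_weight :: "nat \<Rightarrow> real \<Rightarrow> real" where "total_weight t m = 2 * m + \<delta> * (real t + 2)"

lemma attach_prob_eq:
  "attach_prob \<delta> t g u = (real (degree g u) + \<delta>) / total_weight t (real (card (edges g)))"
  by (simp add: attach_prob_def total_weight_def)

lemma total_weight_lower:
  assumes "real t + 1 \<le> m"
  shows "(1 + \<delta>) * (real t + 1) \<le> total_weight t m" "0 < total_weight t m"
proof -
  show "(1 + \<delta>) * (real t + 1) \<le> total_weight t m"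
    using assms delta_gt by (simp add: total_weight_def algebra_simps)
  moreover have "0 < (1 + \<delta>) * (real t + 1)" using delta_gt by (intro mult_pos_pos) auto
  ultimately show "0 < total_weight t m" by linarith
qed

lemma edges_lower: "reachable t g \<Longrightarrow> real t + 1 \<le> real (card (edges g))"
  using reachable_counts[of t g] by simp

lemma attach_prob_nonneg:
  assumes "reachable t g" "u \<in> verts g"
  shows "0 \<le> attach_prob \<delta> t g u"
  unfolding attach_prob_eq
proof (rule divide_nonneg_pos)
  show "0 \<le> real (degree g u) + \<delta>" using delta_gt degree_pos_reachable[OF assms] by linarith
  show "0 < total_weight t (real (card (edges g)))"
    using total_weight_lower(2)[OF edges_lower[OF assms(1)]] .
qed

lemma sum_attach_prob:
  assumes "reachable t g"
  shows "(\<Sum>u\<in>verts g. attach_prob \<delta> t g u) = 1"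
proof -
  let ?D = "total_weight t (real (card (edges g)))"
  have "(\<Sum>u\<in>verts g. real (degree g u) + \<delta>) = ?D"
    using reachable_simple_verts[OF assms] sum_degree[of g] by (simp add: sum.distrib total_weight_def)
  then show ?thesis
    using total_weight_lower(2)[OF edges_lower[OF assms]]
    by (simp add: attach_prob_eq flip: sum_divide_distrib)
qed

lemma sum_edges_uniform:
  assumes "reachable t g"
  shows "(\<Sum>e\<in>edges g. 1 / real (card (edges g))) = 1"
  using reachable_counts[OF assms] by simp

lemma step_mean_one:
  assumes "reachable t g"
  shows "step_mean \<alpha> \<delta> t (\<lambda>_. 1) g = 1"
  using sum_attach_prob[OF assms] sum_edges_uniform[OF assms] by (simp add: step_mean_def)

text \<open>The mean increments of the number of triples when the new vertex is joined to a vertex, respectively to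
  both ends of an edge.\<close>

definition mean_degree_gain :: "nat \<Rightarrow> graph \<Rightarrow> real" where
  "mean_degree_gain t g = (\<Sum>u\<in>verts g. attach_prob \<delta> t g u * real (degree g u))"

definition mean_edge_gain :: "graph \<Rightarrow> real" where
  "mean_edge_gain g = (\<Sum>e\<in>edges g. 1 / real (card (edges g)) * (real (\<Sum>v\<in>e. degree g v) + 1))"

lemma mean_degree_gain_eq:
  assumes "reachable t g"
  shows "mean_degree_gain t g =
    (2 * real (num_triples g) + 2 * (1 + \<delta>) * real (card (edges g))) / total_weight t (real (card (edges g)))"
proof -
  have g: "simple_graph g" using reachable_simple_verts[OF assms] by simp
  have "(\<Sum>u\<in>verts g. (real (degree g u) + \<delta>) * real (degree g u))
      = (\<Sum>u\<in>verts g. (real (degree g u))\<^sup>2) + \<delta> * (\<Sum>u\<in>verts g. real (degree g u))"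
    by (simp add: algebra_simps power2_eq_square sum.distrib sum_distrib_left)
  also have "\<dots> = 2 * real (num_triples g) + 2 * (1 + \<delta>) * real (card (edges g))"
    unfolding sum_degree[OF g] sum_degree_square[OF g] by (simp add: algebra_simps)
  finally show ?thesis
    by (simp add: mean_degree_gain_def attach_prob_eq flip: sum_divide_distrib)
qed

lemma sum_edges_degree:
  assumes "reachable t g"
  shows "(\<Sum>e\<in>edges g. 1 / real (card (edges g)) * real (\<Sum>v\<in>e. degree g v)) =
    2 * real (num_triples g) / real (card (edges g)) + 2"
proof -
  have g: "simple_graph g" using reachable_simple_verts[OF assms] by simp
  have "(\<Sum>e\<in>edges g. real (\<Sum>v\<in>e. degree g v)) = 2 * real (num_triples g) + 2 * real (card (edges g))"
    using sum_degree_mult[OF g, of "\<lambda>v. real (degree g v)"] sum_degree_square[OF g]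
    by (simp add: power2_eq_square)
  then show ?thesis
    using reachable_counts[OF assms] by (simp add: field_simps flip: sum_divide_distrib)
qed

lemma mean_edge_gain_eq:
  assumes "reachable t g"
  shows "mean_edge_gain g = 2 * real (num_triples g) / real (card (edges g)) + 3"
proof -
  have "mean_edge_gain g = (\<Sum>e\<in>edges g. 1 / real (card (edges g)) * real (\<Sum>v\<in>e. degree g v))
      + (\<Sum>e\<in>edges g. 1 / real (card (edges g)))"
    by (simp only: mean_edge_gain_def distrib_left mult_1_right sum.distrib)
  then show ?thesis
    unfolding sum_edges_degree[OF assms] sum_edges_uniform[OF assms] by simp
qed

lemma mean_gain_nonneg:
  assumes "reachable t g"
  shows "0 \<le> mean_degree_gain t g" "0 \<le> mean_edge_gain g"
  using attach_prob_nonneg[OF assms]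
  by (auto simp: mean_degree_gain_def mean_edge_gain_def intro!: sum_nonneg divide_nonneg_nonneg add_nonneg_nonneg)

end

section \<open>The law of the process\<close>

locale clustering_process = random_graph_process M G \<alpha> \<delta> + attachment_parameters \<alpha> \<delta>
  for M :: "'a measure" and G \<alpha> \<delta>
begin

lemma measurable_comp_G [measurable]: "(\<lambda>\<omega>. f (G t \<omega>)) \<in> borel_measurable M"
  by (rule measurable_compose[OF measurable_G]) simp

lemma sets_G [measurable]: "Measurable.pred M (\<lambda>\<omega>. P (G t \<omega>))"
  by (rule measurable_compose[OF measurable_G]) simp

lemma prob_step_past:
  "prob {\<omega> \<in> space M. G (Suc t) \<omega> = h \<and> (\<forall>s\<le>t. G s \<omega> = g s)} =
   step_prob \<alpha> \<delta> t (g t) h * prob {\<omega> \<in> space M. \<forall>s\<le>t. G s \<omega> = g s}"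
proof (cases "prob {\<omega> \<in> space M. \<forall>s\<le>t. G s \<omega> = g s} > 0")
  case True
  then show ?thesis using step[OF True, of h] by (simp add: cond_prob_def field_simps)
next
  case False
  then have 0: "prob {\<omega> \<in> space M. \<forall>s\<le>t. G s \<omega> = g s} = 0"
    using measure_nonneg[of M] by (meson linorder_not_less order_antisym)
  have "prob {\<omega> \<in> space M. G (Suc t) \<omega> = h \<and> (\<forall>s\<le>t. G s \<omega> = g s)}
      \<le> prob {\<omega> \<in> space M. \<forall>s\<le>t. G s \<omega> = g s}"
    by (intro finite_measure_mono) auto
  then show ?thesis using 0 by (simp add: order_antisym)
qed

text \<open>Total probability over the values of \<open>Y\<close>. Only the level sets of \<open>Y\<close> have to be measurable, so that \<open>Y\<close>
  can be the whole past of the process.\<close>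

lemma prob_partition:
  assumes "finite I" and "AE \<omega> in M. Y \<omega> \<in> I"
    and "\<And>i. i \<in> I \<Longrightarrow> {\<omega> \<in> space M. P \<omega> \<and> Y \<omega> = i} \<in> events" and "{\<omega> \<in> space M. P \<omega>} \<in> events"
  shows "prob {\<omega> \<in> space M. P \<omega>} = (\<Sum>i\<in>I. prob {\<omega> \<in> space M. P \<omega> \<and> Y \<omega> = i})"
proof -
  have "prob {\<omega> \<in> space M. P \<omega>} = prob (\<Union>i\<in>I. {\<omega> \<in> space M. P \<omega> \<and> Y \<omega> = i})"
    using assms by (intro finite_measure_eq_AE) auto
  also have "\<dots> = (\<Sum>i\<in>I. prob {\<omega> \<in> space M. P \<omega> \<and> Y \<omega> = i})"
    using assms by (intro finite_measure_finite_Union) (auto simp: disjoint_family_on_def)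
  finally show ?thesis .
qed

text \<open>The transition probabilities are given conditionally on the whole past. Summing over the finitely many
  possible pasts that end in \<open>g\<close> gives the Markov property at a single time.\<close>

lemma prob_step:
  assumes "AE \<omega> in M. \<forall>s\<le>t. reachable s (G s \<omega>)"
  shows "prob {\<omega> \<in> space M. G (Suc t) \<omega> = h \<and> G t \<omega> = g} =
    step_prob \<alpha> \<delta> t g h * prob {\<omega> \<in> space M. G t \<omega> = g}"
proof -
  define past where "past \<omega> = restrict (\<lambda>s. G s \<omega>) {..t}" for \<omega>
  define I where "I = (\<Pi>\<^sub>E s\<in>{..t}. {g. reachable s g})"
  have fin: "finite I" unfolding I_def by (intro finite_PiE finite_reachable) simp
  have past_in: "AE \<omega> in M. past \<omega> \<in> I"
    using assms by eventually_elim (auto simp: past_def I_def)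
  have past_eq: "past \<omega> = \<tau> \<longleftrightarrow> (\<forall>s\<le>t. G s \<omega> = \<tau> s)" if "\<tau> \<in> I" for \<omega> \<tau>
    using that by (auto simp: past_def I_def fun_eq_iff PiE_def extensional_def)
  have summand: "prob {\<omega> \<in> space M. (G (Suc t) \<omega> = h \<and> G t \<omega> = g) \<and> past \<omega> = \<tau>}
      = step_prob \<alpha> \<delta> t g h * prob {\<omega> \<in> space M. G t \<omega> = g \<and> past \<omega> = \<tau>}" if "\<tau> \<in> I" for \<tau>
  proof (cases "\<tau> t = g")
    case True
    have "{\<omega> \<in> space M. (G (Suc t) \<omega> = h \<and> G t \<omega> = g) \<and> past \<omega> = \<tau>}
        = {\<omega> \<in> space M. G (Suc t) \<omega> = h \<and> (\<forall>s\<le>t. G s \<omega> = \<tau> s)}"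
      "{\<omega> \<in> space M. G t \<omega> = g \<and> past \<omega> = \<tau>} = {\<omega> \<in> space M. \<forall>s\<le>t. G s \<omega> = \<tau> s}"
      using True by (auto simp: past_eq[OF that])
    then show ?thesis using prob_step_past[of t h \<tau>] True by simp
  next
    case False
    then have "{\<omega> \<in> space M. (G (Suc t) \<omega> = h \<and> G t \<omega> = g) \<and> past \<omega> = \<tau>} = {}"
      "{\<omega> \<in> space M. G t \<omega> = g \<and> past \<omega> = \<tau>} = {}"
      by (auto simp: past_eq[OF that])
    then show ?thesis by (simp only: measure_empty mult_zero_right)
  qed
  have "prob {\<omega> \<in> space M. G (Suc t) \<omega> = h \<and> G t \<omega> = g}
      = (\<Sum>\<tau>\<in>I. prob {\<omega> \<in> space M. (G (Suc t) \<omega> = h \<and> G t \<omega> = g) \<and> past \<omega> = \<tau>})"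
    by (rule prob_partition[OF fin past_in]) (simp_all add: past_eq)
  also have "\<dots> = step_prob \<alpha> \<delta> t g h * (\<Sum>\<tau>\<in>I. prob {\<omega> \<in> space M. G t \<omega> = g \<and> past \<omega> = \<tau>})"
    unfolding sum_distrib_left by (rule sum.cong[OF refl summand])
  also have "(\<Sum>\<tau>\<in>I. prob {\<omega> \<in> space M. G t \<omega> = g \<and> past \<omega> = \<tau>}) = prob {\<omega> \<in> space M. G t \<omega> = g}"
    by (rule prob_partition[OF fin past_in, symmetric]) (simp_all add: past_eq)
  finally show ?thesis .
qed

lemma expectation_eq_sum:
  assumes "AE \<omega> in M. reachable t (G t \<omega>)"
  shows "integrable M (\<lambda>\<omega>. f (G t \<omega>))"
    and "expectation (\<lambda>\<omega>. f (G t \<omega>)) = (\<Sum>g | reachable t g. prob {\<omega> \<in> space M. G t \<omega> = g} * f g)"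
proof -
  let ?S = "\<lambda>\<omega>. \<Sum>g | reachable t g. f g * indicator {\<omega> \<in> space M. G t \<omega> = g} \<omega>"
  have ae: "AE \<omega> in M. f (G t \<omega>) = ?S \<omega>"
    using assms AE_space
  proof eventually_elim
    case (elim \<omega>)
    have "?S \<omega> = (\<Sum>g | reachable t g. if g = G t \<omega> then f g else 0)"
      using elim by (intro sum.cong) (auto simp: indicator_def)
    then show ?case using elim finite_reachable by (simp add: sum.delta)
  qed
  have int: "integrable M (\<lambda>\<omega>. f g * indicator {\<omega> \<in> space M. G t \<omega> = g} \<omega> :: real)" for g
    by (intro integrable_mult_right integrable_real_indicator) (auto simp: emeasure_eq_measure)
  then have intS: "integrable M ?S" by (intro Bochner_Integration.integrable_sum)
  show "integrable M (\<lambda>\<omega>. f (G t \<omega>))"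
    using intS by (rule integrable_cong_AE_imp) (use ae in \<open>auto\<close>)
  have "expectation (\<lambda>\<omega>. f (G t \<omega>)) = expectation ?S"
    using ae intS by (intro integral_cong_AE) auto
  also have "\<dots> = (\<Sum>g | reachable t g. prob {\<omega> \<in> space M. G t \<omega> = g} * f g)"
    using int by (subst Bochner_Integration.integral_sum) (auto simp: mult.commute)
  finally show "expectation (\<lambda>\<omega>. f (G t \<omega>)) = (\<Sum>g | reachable t g. prob {\<omega> \<in> space M. G t \<omega> = g} * f g)" .
qed

lemma prob_next:
  assumes "AE \<omega> in M. \<forall>s\<le>t. reachable s (G s \<omega>)"
  shows "prob {\<omega> \<in> space M. G (Suc t) \<omega> = h} =
    (\<Sum>g | reachable t g. prob {\<omega> \<in> space M. G t \<omega> = g} * step_prob \<alpha> \<delta> t g h)"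
proof -
  have "AE \<omega> in M. G t \<omega> \<in> {g. reachable t g}" using assms by eventually_elim auto
  then have "prob {\<omega> \<in> space M. G (Suc t) \<omega> = h} =
      (\<Sum>g | reachable t g. prob {\<omega> \<in> space M. G (Suc t) \<omega> = h \<and> G t \<omega> = g})"
    by (intro prob_partition finite_reachable) auto
  then show ?thesis by (simp add: prob_step[OF assms] mult.commute)
qed

lemma sum_prob_next:
  assumes "AE \<omega> in M. \<forall>s\<le>t. reachable s (G s \<omega>)"
  shows "(\<Sum>h | reachable (Suc t) h. prob {\<omega> \<in> space M. G (Suc t) \<omega> = h} * f h) =
    expectation (\<lambda>\<omega>. step_mean \<alpha> \<delta> t f (G t \<omega>))"
proof -
  have "AE \<omega> in M. reachable t (G t \<omega>)" using assms by eventually_elim auto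
  then have "expectation (\<lambda>\<omega>. step_mean \<alpha> \<delta> t f (G t \<omega>))
      = (\<Sum>g | reachable t g. prob {\<omega> \<in> space M. G t \<omega> = g} *
          (\<Sum>h | reachable (Suc t) h. step_prob \<alpha> \<delta> t g h * f h))"
    by (subst expectation_eq_sum) (auto simp: sum_step_prob)
  also have "\<dots> = (\<Sum>h | reachable (Suc t) h. \<Sum>g | reachable t g.
      prob {\<omega> \<in> space M. G t \<omega> = g} * step_prob \<alpha> \<delta> t g h * f h)"
    by (subst sum.swap) (simp add: sum_distrib_left mult.assoc)
  finally show ?thesis by (simp add: prob_next[OF assms] sum_distrib_right)
qed

text \<open>The transition probabilities from a reachable graph to reachable graphs add up to 1, since this sum is
  the average of the constant 1 over a step.\<close>

lemma AE_all_reachable: "AE \<omega> in M. \<forall>s\<le>t. reachable s (G s \<omega>)"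
proof (induction t)
  case 0
  show ?case using initial by eventually_elim (auto intro: reachable.start)
next
  case (Suc t)
  have "AE \<omega> in M. reachable t (G t \<omega>)" using Suc by eventually_elim auto
  then have "expectation (\<lambda>\<omega>. step_mean \<alpha> \<delta> t (\<lambda>_. 1) (G t \<omega>)) = expectation (\<lambda>\<omega>. 1)"
    by (intro integral_cong_AE) (auto simp: step_mean_one)
  then have "(\<Sum>h | reachable (Suc t) h. prob {\<omega> \<in> space M. G (Suc t) \<omega> = h}) = 1"
    using sum_prob_next[OF Suc, of "\<lambda>_. 1"] by (simp add: prob_space)
  also have "(\<Sum>h | reachable (Suc t) h. prob {\<omega> \<in> space M. G (Suc t) \<omega> = h})
      = prob (\<Union>h\<in>{h. reachable (Suc t) h}. {\<omega> \<in> space M. G (Suc t) \<omega> = h})"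
    using finite_reachable
    by (intro finite_measure_finite_Union[symmetric]) (auto simp: disjoint_family_on_def)
  also have "(\<Union>h\<in>{h. reachable (Suc t) h}. {\<omega> \<in> space M. G (Suc t) \<omega> = h})
      = {\<omega> \<in> space M. reachable (Suc t) (G (Suc t) \<omega>)}" by auto
  finally have "AE \<omega> in M. reachable (Suc t) (G (Suc t) \<omega>)"
    by (subst (asm) prob_Collect_eq_1) auto
  then show ?case using Suc by eventually_elim (auto simp: le_Suc_eq)
qed

lemma AE_reachable: "AE \<omega> in M. reachable t (G t \<omega>)"
  using AE_all_reachable[of t] by eventually_elim auto

lemmas integrable_G = expectation_eq_sum(1)[OF AE_reachable]

lemma expectation_step:
  "expectation (\<lambda>\<omega>. f (G (Suc t) \<omega>)) = expectation (\<lambda>\<omega>. step_mean \<alpha> \<delta> t f (G t \<omega>))"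
  using expectation_eq_sum(2)[OF AE_reachable, of f "Suc t"] sum_prob_next[OF AE_all_reachable, of t f]
  by simp

lemma expectation_mono:
  fixes f f' :: "graph \<Rightarrow> real"
  assumes "\<And>g. reachable t g \<Longrightarrow> f g \<le> f' g"
  shows "expectation (\<lambda>\<omega>. f (G t \<omega>)) \<le> expectation (\<lambda>\<omega>. f' (G t \<omega>))"
proof (rule integral_mono_AE[OF integrable_G integrable_G])
  show "AE \<omega> in M. f (G t \<omega>) \<le> f' (G t \<omega>)"
    using AE_reachable[of t] by eventually_elim (rule assms)
qed

lemma expectation_initial:
  fixes f :: "graph \<Rightarrow> real"
  shows "expectation (\<lambda>\<omega>. f (G 0 \<omega>)) = f initial_graph"
proof -
  have "expectation (\<lambda>\<omega>. f (G 0 \<omega>)) = expectation (\<lambda>\<omega>. f initial_graph)"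
    by (intro integral_cong_AE) (use initial in auto)
  then show ?thesis by (simp add: prob_space)
qed

lemma expectation_linear:
  fixes f f' :: "graph \<Rightarrow> real"
  shows "expectation (\<lambda>\<omega>. a * f (G t \<omega>) + b * f' (G t \<omega>))
    = a * expectation (\<lambda>\<omega>. f (G t \<omega>)) + b * expectation (\<lambda>\<omega>. f' (G t \<omega>))"
  using integrable_G[of f t] integrable_G[of f' t] by simp

text \<open>Jensen's inequality for the square, from \<open>f\<^sup>2 \<ge> 2 m f - m\<^sup>2\<close> with \<open>m\<close> the mean of \<open>f\<close>.\<close>

lemma expectation_square_ge:
  fixes f :: "graph \<Rightarrow> real"
  shows "(expectation (\<lambda>\<omega>. f (G t \<omega>)))\<^sup>2 \<le> expectation (\<lambda>\<omega>. (f (G t \<omega>))\<^sup>2)"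
proof -
  define m where "m = expectation (\<lambda>\<omega>. f (G t \<omega>))"
  have "expectation (\<lambda>\<omega>. 2 * m * f (G t \<omega>) + - (m\<^sup>2) * 1) \<le> expectation (\<lambda>\<omega>. (f (G t \<omega>))\<^sup>2)"
  proof (rule expectation_mono)
    fix g show "2 * m * f g + - (m\<^sup>2) * 1 \<le> (f g)\<^sup>2"
      using zero_le_power2[of "f g - m"] by (simp add: power2_eq_square algebra_simps)
  qed
  also have "expectation (\<lambda>\<omega>. 2 * m * f (G t \<omega>) + - (m\<^sup>2) * 1) = m\<^sup>2"
    using expectation_linear[of "2 * m" f t "- (m\<^sup>2)" "\<lambda>_. 1"]
    by (simp add: prob_space m_def power2_eq_square)
  finally show ?thesis by (simp add: m_def)
qed

end

section \<open>Elementary inequalities\<close>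

lemma exp_upper_quadratic:
  fixes z :: real
  assumes "0 \<le> z" "z \<le> L"
  shows "exp z \<le> 1 + z + exp L * z\<^sup>2"
proof (cases "z \<le> 1")
  case True
  have "z\<^sup>2 \<le> exp L * z\<^sup>2" using assms mult_right_mono[of 1 "exp L" "z\<^sup>2"] by simp
  then show ?thesis using exp_bound[OF assms(1) True] by linarith
next
  case False
  then have "1 \<le> z\<^sup>2" by simp
  then have "exp z \<le> exp L * z\<^sup>2"
    using assms(2) mult_mono[of "exp z" "exp L" 1 "z\<^sup>2"] by simp
  then show ?thesis using False by linarith
qed

lemma inverse_one_plus_le:
  fixes u :: real
  assumes "0 \<le> u"
  shows "1 / (1 + u) \<le> 1 - u + u\<^sup>2"
proof -
  have "(1 - u + u\<^sup>2) * (1 + u) = 1 + u ^ 3" by algebra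
  then show ?thesis using assms by (simp add: pos_divide_le_eq)
qed

text \<open>\<open>\<rho>\<close> is the factor by which \<open>E\<^sup>a D\<^sup>b\<close> grows when \<open>E\<close> and \<open>D\<close> grow by the factors \<open>1 + x\<close> and \<open>1 + y\<close>. To
  first order it is \<open>1 + z\<close>; the two bounds control the quadratic errors of \<open>\<rho>\<close> and \<open>1 / \<rho>\<close>. Both follow
  from \<open>\<rho> = exp u\<close>, where \<open>u\<close> differs from \<open>z\<close> by at most \<open>a x\<^sup>2 + b y\<^sup>2\<close>.\<close>

lemma powr_product_bounds:
  fixes a b x y :: real
  assumes "0 \<le> a" "0 \<le> b" "0 \<le> x" "0 \<le> y" and L: "a * x + b * y \<le> L"
  defines "\<rho> \<equiv> (1 + x) powr a * (1 + y) powr b" and "z \<equiv> a * x + b * y"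
  shows "1 \<le> \<rho>" and "\<rho> \<le> 1 + z + exp L * z\<^sup>2"
    and "1 / \<rho> \<le> 1 - z + (a * x\<^sup>2 + b * y\<^sup>2 + z\<^sup>2)"
proof -
  define u where "u = a * ln (1 + x) + b * ln (1 + y)"
  have rho: "\<rho> = exp u" using assms by (simp add: \<rho>_def u_def powr_def exp_add)
  have ln_lower: "s - s\<^sup>2 \<le> ln (1 + s)" if "0 \<le> s" for s :: real
  proof (cases "s \<le> 1")
    case True
    then show ?thesis using ln_one_plus_pos_lower_bound that by blast
  next
    case False
    then have "s \<le> s\<^sup>2" by (simp add: power2_eq_square)
    then show ?thesis using ln_ge_zero[of "1 + s"] that by linarith
  qed
  have "0 \<le> u" unfolding u_def using assms by (intro add_nonneg_nonneg mult_nonneg_nonneg) auto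
  have "u \<le> z" unfolding u_def z_def
    using assms by (intro add_mono mult_left_mono ln_add_one_self_le_self) auto
  have "a * (x - x\<^sup>2) + b * (y - y\<^sup>2) \<le> u"
    unfolding u_def using assms by (intro add_mono mult_left_mono ln_lower) auto
  then have lower: "z - (a * x\<^sup>2 + b * y\<^sup>2) \<le> u" by (simp add: z_def algebra_simps)
  show "1 \<le> \<rho>" using \<open>0 \<le> u\<close> by (simp add: rho)
  have "exp u \<le> exp z" using \<open>u \<le> z\<close> by simp
  also have "\<dots> \<le> 1 + z + exp L * z\<^sup>2"
    using \<open>0 \<le> u\<close> \<open>u \<le> z\<close> L by (intro exp_upper_quadratic) (auto simp: z_def)
  finally show "\<rho> \<le> 1 + z + exp L * z\<^sup>2" by (simp add: rho)
  have "1 / \<rho> \<le> 1 / (1 + u)"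
    using \<open>0 \<le> u\<close> exp_ge_add_one_self[of u] by (simp add: rho frac_le)
  also have "\<dots> \<le> 1 - u + u\<^sup>2" using \<open>0 \<le> u\<close> by (rule inverse_one_plus_le)
  also have "\<dots> \<le> 1 - z + (a * x\<^sup>2 + b * y\<^sup>2 + z\<^sup>2)"
    using lower power_mono[OF \<open>u \<le> z\<close> \<open>0 \<le> u\<close>, of 2] by linarith
  finally show "1 / \<rho> \<le> 1 - z + (a * x\<^sup>2 + b * y\<^sup>2 + z\<^sup>2)" .
qed

text \<open>The square \<open>(d / C)\<^sup>2\<close> in the expansion of \<open>1 / (C + d)\<close> is replaced by a multiple of \<open>d / C\<close> that is small
  when \<open>C\<close> is large. The bound is then linear in \<open>d\<close> and can be averaged knowing only the mean of \<open>d\<close>.\<close>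

lemma inverse_increment_le:
  fixes C d :: real
  assumes "0 < C" "0 \<le> d" "d \<le> 7 * sqrt C"
  shows "1 / (C + d) \<le> (1 - d / C + 7 / sqrt C * (d / C)) / C"
proof -
  have r: "sqrt C * sqrt C = C" "0 < sqrt C" using assms by auto
  have "(1 + d / C) * C = C + d" using assms by (simp add: distrib_right)
  then have "1 / (C + d) = 1 / (1 + d / C) / C" by simp
  also have "\<dots> \<le> (1 - d / C + (d / C)\<^sup>2) / C"
    using assms by (intro divide_right_mono inverse_one_plus_le) auto
  also have "\<dots> \<le> (1 - d / C + 7 / sqrt C * (d / C)) / C"
  proof -
    have "d / C \<le> 7 * sqrt C / C" using assms by (intro divide_right_mono) auto
    also have "\<dots> = 7 / sqrt C" using r assms by (simp add: field_simps)
    finally have "d / C * (d / C) \<le> 7 / sqrt C * (d / C)" using assms by (intro mult_right_mono) auto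
    then show ?thesis using assms by (intro divide_right_mono add_left_mono) (auto simp: power2_eq_square)
  qed
  finally show ?thesis .
qed

section \<open>A growth scale for the number of triples\<close>

context attachment_parameters begin

text \<open>The exponents solve \<open>edge_exponent * (1 + \<alpha>) = 2 * \<alpha>\<close> and
  \<open>weight_exponent * (2 * (1 + \<alpha>) + \<delta>) = 2 * (1 - \<alpha>)\<close>. Here \<open>1 + \<alpha>\<close> and \<open>2 * (1 + \<alpha>) + \<delta>\<close> are the mean
  increments of the number of edges and of the total attachment weight in one step.\<close>

definition edge_exponent :: real where "edge_exponent = 2 * \<alpha> / (1 + \<alpha>)"

definition weight_exponent :: real where "weight_exponent = 2 * (1 - \<alpha>) / (2 * (1 + \<alpha>) + \<delta>)"

definition growth :: "nat \<Rightarrow> real \<Rightarrow> real" where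
  "growth t m = m powr edge_exponent * total_weight t m powr weight_exponent"

definition growth_exponent :: real where "growth_exponent = edge_exponent + weight_exponent"

lemma exponents_nonneg: "0 \<le> edge_exponent" "0 \<le> weight_exponent"
  using alpha_pos alpha_le_1 delta_gt by (auto simp: edge_exponent_def weight_exponent_def)

lemma growth_pos: "real t + 1 \<le> m \<Longrightarrow> 0 < growth t m"
  using total_weight_lower(2)[of t m] by (simp add: growth_def)

text \<open>The first-order increment of the logarithm of \<open>growth\<close> in a step that adds \<open>k\<close> edges to a graph with \<open>m\<close>
  edges at time \<open>t\<close>.\<close>

definition log_increment :: "nat \<Rightarrow> real \<Rightarrow> real \<Rightarrow> real" where
  "log_increment t m k = edge_exponent * (k / m) + weight_exponent * ((2 * k + \<delta>) / total_weight t m)"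

definition growth_ratio :: "nat \<Rightarrow> real \<Rightarrow> real \<Rightarrow> real" where
  "growth_ratio t m k = growth (Suc t) (m + k) / growth t m"

text \<open>The right-hand side is the relative growth rate of the number of triples in one step. This identity,
  valid for every number \<open>m\<close> of edges, is the reason for the choice of the exponents.\<close>

lemma mean_log_increment:
  assumes "real t + 1 \<le> m"
  shows "(1 - \<alpha>) * log_increment t m 1 + \<alpha> * log_increment t m 2
    = 2 * \<alpha> / m + 2 * (1 - \<alpha>) / total_weight t m"
proof -
  have "(1 - \<alpha>) * log_increment t m 1 + \<alpha> * log_increment t m 2
    = edge_exponent * (1 + \<alpha>) / m + weight_exponent * (2 * (1 + \<alpha>) + \<delta>) / total_weight t m"
    using assms total_weight_lower(2)[OF assms] by (simp add: log_increment_def field_simps)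
  also have "edge_exponent * (1 + \<alpha>) = 2 * \<alpha>"
    using alpha_pos by (simp add: edge_exponent_def)
  also have "weight_exponent * (2 * (1 + \<alpha>) + \<delta>) = 2 * (1 - \<alpha>)"
    using alpha_pos delta_gt by (simp add: weight_exponent_def)
  finally show ?thesis .
qed

text \<open>The relative increments of the number of edges and of the total weight are of order
  \<open>1 / (t + 1)\<close>, so all quadratic errors are of order \<open>1 / (t + 1)\<^sup>2\<close>, uniformly in \<open>m\<close>.\<close>

lemma growth_ratio_bounds:
  obtains K where "0 \<le> K"
    and "\<And>t m k. real t + 1 \<le> m \<Longrightarrow> k = 1 \<or> k = 2 \<Longrightarrow>
      0 \<le> log_increment t m k \<and> 1 \<le> growth_ratio t m k \<and> growth_ratio t m k \<le> K \<and>
      growth_ratio t m k \<le> 1 + log_increment t m k + K / (real t + 1)\<^sup>2 \<and>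
      1 / growth_ratio t m k \<le> 1 - log_increment t m k + K / (real t + 1)\<^sup>2"
proof -
  define Y where "Y = (4 + \<delta>) / (1 + \<delta>)"
  define L where "L = edge_exponent * 2 + weight_exponent * Y"
  define K1 where "K1 = exp L * L\<^sup>2"
  define K2 where "K2 = edge_exponent * 2\<^sup>2 + weight_exponent * Y\<^sup>2 + L\<^sup>2"
  have Y: "0 \<le> Y" using delta_gt by (simp add: Y_def)
  have L: "0 \<le> L" using Y exponents_nonneg by (simp add: L_def)
  have K: "0 \<le> K1" "0 \<le> K2" using Y exponents_nonneg by (simp_all add: K1_def K2_def)
  show ?thesis
  proof
    show "0 \<le> 1 + L + K1 + K2" using L K by simp
  next
    fix t :: nat and m k :: real
    assume m: "real t + 1 \<le> m" and k: "k = 1 \<or> k = 2"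
    define s where "s = real t + 1"
    define x where "x = k / m"
    define y where "y = (2 * k + \<delta>) / total_weight t m"
    note D = total_weight_lower[OF m]
    have s: "1 \<le> s" "s \<le> m" using m by (simp_all add: s_def)
    have x: "0 \<le> x" "x \<le> 2 / s" using k s by (auto simp: x_def intro!: frac_le)
    have y: "0 \<le> y" "y \<le> Y / s"
    proof -
      show "0 \<le> y" using k D delta_gt by (auto simp: y_def)
      have "y \<le> (4 + \<delta>) / ((1 + \<delta>) * s)"
        unfolding y_def using k D delta_gt s by (intro frac_le) (auto simp: s_def)
      then show "y \<le> Y / s" by (simp add: Y_def)
    qed
    define z where "z = edge_exponent * x + weight_exponent * y"
    have z0: "0 \<le> z" using x y exponents_nonneg by (simp add: z_def)
    have "z \<le> edge_exponent * (2 / s) + weight_exponent * (Y / s)"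
      unfolding z_def using x y exponents_nonneg by (intro add_mono mult_left_mono) auto
    then have zL: "z \<le> L / s" by (simp add: L_def add_divide_distrib)
    also have "\<dots> \<le> L / 1" using L s by (intro divide_left_mono) auto
    finally have zL1: "z \<le> L" by simp
    have sq: "x\<^sup>2 \<le> 2\<^sup>2 / s\<^sup>2" "y\<^sup>2 \<le> Y\<^sup>2 / s\<^sup>2" "z\<^sup>2 \<le> L\<^sup>2 / s\<^sup>2"
      using power_mono[OF x(2) x(1), of 2] power_mono[OF y(2) y(1), of 2] power_mono[OF zL z0, of 2]
      by (simp_all add: power_divide)
    have z: "log_increment t m k = z" by (simp add: log_increment_def z_def x_def y_def)
    have rho: "growth_ratio t m k = (1 + x) powr edge_exponent * (1 + y) powr weight_exponent"
    proof -
      have "m + k = m * (1 + x)" using s by (simp add: x_def field_simps)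
      moreover have "total_weight (Suc t) (m + k) = total_weight t m * (1 + y)"
        using D by (simp add: y_def field_simps) (simp add: total_weight_def algebra_simps)
      ultimately show ?thesis
        using s D x y by (simp add: growth_ratio_def growth_def powr_mult)
    qed
    note pb = powr_product_bounds[OF exponents_nonneg x(1) y(1) zL1[unfolded z_def], folded rho z_def]
    have up: "exp L * z\<^sup>2 \<le> K1 / s\<^sup>2" using mult_left_mono[OF sq(3), of "exp L"] by (simp add: K1_def)
    have low: "edge_exponent * x\<^sup>2 + weight_exponent * y\<^sup>2 + z\<^sup>2 \<le> K2 / s\<^sup>2"
    proof -
      have "edge_exponent * x\<^sup>2 + weight_exponent * y\<^sup>2 + z\<^sup>2
          \<le> edge_exponent * (2\<^sup>2 / s\<^sup>2) + weight_exponent * (Y\<^sup>2 / s\<^sup>2) + L\<^sup>2 / s\<^sup>2"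
        using sq exponents_nonneg by (intro add_mono mult_left_mono) auto
      then show ?thesis by (simp add: K2_def add_divide_distrib)
    qed
    have mono: "c / s\<^sup>2 \<le> (1 + L + K1 + K2) / s\<^sup>2" if "c = K1 \<or> c = K2" for c
      using that K L by (intro divide_right_mono) auto
    have "K1 / s\<^sup>2 \<le> K1 / 1" using K s by (intro divide_left_mono) auto
    then show "0 \<le> log_increment t m k \<and> 1 \<le> growth_ratio t m k \<and> growth_ratio t m k \<le> 1 + L + K1 + K2 \<and>
      growth_ratio t m k \<le> 1 + log_increment t m k + (1 + L + K1 + K2) / (real t + 1)\<^sup>2 \<and>
      1 / growth_ratio t m k \<le> 1 - log_increment t m k + (1 + L + K1 + K2) / (real t + 1)\<^sup>2"
      using pb up low mono[of K1] mono[of K2] z0 zL1 K unfolding z s_def[symmetric] by linarith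
  qed
qed

lemma growth_step:
  assumes "real t + 1 \<le> m"
  shows "growth (Suc t) (m + k) = growth t m * growth_ratio t m k"
  using growth_pos[OF assms] by (simp add: growth_ratio_def)

definition normalisation :: "nat \<Rightarrow> graph \<Rightarrow> real" where
  "normalisation t g = growth t (real (card (edges g)))"

lemma normalisation_pos: "reachable t g \<Longrightarrow> 0 < normalisation t g"
  using growth_pos edges_lower by (simp add: normalisation_def)

text \<open>The number of edges and the total weight fluctuate, but both stay between constant multiples of
  \<open>t + 1\<close>.\<close>

lemma normalisation_bounds:
  obtains c C where "0 < c" "0 < C"
    and "\<And>t g. reachable t g \<Longrightarrow>
      c * (real t + 1) powr growth_exponent \<le> normalisation t g \<and>
      normalisation t g \<le> C * (real t + 1) powr growth_exponent"
proof
  show "0 < (1 + \<delta>) powr weight_exponent" using delta_gt by simp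
  show "0 < 2 powr edge_exponent * (4 + 2 * \<bar>\<delta>\<bar>) powr weight_exponent" by simp
  fix t g assume g: "reachable t g"
  define s where "s = real t + 1"
  define m where "m = real (card (edges g))"
  have s: "1 \<le> s" by (simp add: s_def)
  have m: "s \<le> m" "m \<le> 2 * s" using reachable_counts[OF g] by (auto simp: s_def m_def)
  have "\<delta> * (s + 1) \<le> \<bar>\<delta>\<bar> * (2 * s)" using s by (intro mult_mono) auto
  then have up: "total_weight t m \<le> (4 + 2 * \<bar>\<delta>\<bar>) * s"
    using m by (simp add: total_weight_def s_def algebra_simps)
  have D: "(1 + \<delta>) * s \<le> total_weight t m" "0 < total_weight t m"
    using total_weight_lower[of t m] m by (auto simp: s_def)
  have split: "s powr growth_exponent = s powr edge_exponent * s powr weight_exponent"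
    by (simp add: growth_exponent_def powr_add)
  have "s powr edge_exponent * ((1 + \<delta>) * s) powr weight_exponent \<le> normalisation t g"
    unfolding normalisation_def growth_def m_def[symmetric]
    using m D s exponents_nonneg delta_gt by (intro mult_mono powr_mono2) auto
  moreover have "normalisation t g \<le> (2 * s) powr edge_exponent * ((4 + 2 * \<bar>\<delta>\<bar>) * s) powr weight_exponent"
    unfolding normalisation_def growth_def m_def[symmetric]
    using m D s up exponents_nonneg by (intro mult_mono powr_mono2) auto
  ultimately show "(1 + \<delta>) powr weight_exponent * (real t + 1) powr growth_exponent
        \<le> normalisation t g \<and>
      normalisation t g \<le> 2 powr edge_exponent * (4 + 2 * \<bar>\<delta>\<bar>) powr weight_exponent *
        (real t + 1) powr growth_exponent"
    using s delta_gt unfolding s_def[symmetric] split by (simp add: powr_mult mult_ac)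
qed

end

section \<open>Drift of the rescaled number of triples and of its inverse\<close>

context attachment_parameters begin

text \<open>The mean increment of the number of triples is \<open>rate * C\<close> plus a bounded remainder. The upper estimate of
  the remainder serves the bound on \<open>C\<close>, and its positive lower estimate \<open>3 \<alpha>\<close> produces the logarithm
  in the critical case.\<close>

lemma mean_gain_bounds:
  assumes g: "reachable t g"
  defines "m \<equiv> real (card (edges g))" and "C \<equiv> real (num_triples g)"
  defines "rate \<equiv> (1 - \<alpha>) * log_increment t m 1 + \<alpha> * log_increment t m 2"
  defines "gain \<equiv> (1 - \<alpha>) * mean_degree_gain t g + \<alpha> * mean_edge_gain g"
  shows "rate * C + 3 * \<alpha> \<le> gain" and "gain \<le> rate * C + 7"
proof -
  have m: "real t + 1 \<le> m" "m \<le> 2 * (real t + 1)" using reachable_counts[OF g] by (auto simp: m_def)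
  note D = total_weight_lower[OF m(1)]
  define c where "c = 2 * (1 + \<delta>) * m / total_weight t m"
  have c0: "0 \<le> c" using delta_gt D m by (simp add: c_def)
  have "2 * (1 + \<delta>) * m \<le> 2 * (1 + \<delta>) * (2 * (real t + 1))"
    using m delta_gt by (intro mult_left_mono) auto
  also have "\<dots> \<le> 4 * total_weight t m" using D by (simp add: algebra_simps)
  finally have c4: "c \<le> 4" using D by (simp add: c_def pos_divide_le_eq)
  have rate: "rate = 2 * \<alpha> / m + 2 * (1 - \<alpha>) / total_weight t m"
    unfolding rate_def by (rule mean_log_increment[OF m(1)])
  have gain: "gain = rate * C + ((1 - \<alpha>) * c + 3 * \<alpha>)"
    unfolding gain_def rate mean_degree_gain_eq[OF g] mean_edge_gain_eq[OF g] m_def[symmetric] C_def[symmetric]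
      c_def
    using D m by (simp add: field_simps)
  have "0 \<le> (1 - \<alpha>) * c" "(1 - \<alpha>) * c \<le> 1 * 4"
    using c0 c4 alpha_pos alpha_le_1 mult_mono[of "1 - \<alpha>" 1 c 4] by auto
  then show "rate * C + 3 * \<alpha> \<le> gain" "gain \<le> rate * C + 7"
    unfolding gain using alpha_le_1 by auto
qed

lemma normalisation_next:
  assumes "reachable t g"
  defines "m \<equiv> real (card (edges g))"
  shows "u \<in> verts g \<Longrightarrow>
      normalisation (Suc t) (join_edge (t + 3) g {u}) = normalisation t g * growth_ratio t m 1"
    and "e \<in> edges g \<Longrightarrow>
      normalisation (Suc t) (join_edge (t + 3) g e) = normalisation t g * growth_ratio t m 2"
  using vertex_attachment_counts(1)[OF assms(1), of u] edge_attachment_counts(1)[OF assms(1), of e]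
    growth_step[OF edges_lower[OF assms(1)], unfolded add.commute[of "real (card (edges g))"]]
  by (simp_all add: normalisation_def m_def)

text \<open>The rate at which the number of triples grows cancels against the growth rate of the scale. The
  remainder of the mean increment contributes the last term, and the quadratic errors a summable
  factor.\<close>

lemma triples_drift:
  obtains K where "0 \<le> K"
    and "\<And>t g. reachable t g \<Longrightarrow>
      step_mean \<alpha> \<delta> t (\<lambda>h. real (num_triples h) / normalisation (Suc t) h) g
        \<le> real (num_triples g) / normalisation t g * (1 + K / (real t + 1)\<^sup>2) + 7 / normalisation t g"
proof -
  obtain K where K: "0 \<le> K"
    and ratio: "\<And>t m k. real t + 1 \<le> m \<Longrightarrow> k = 1 \<or> k = 2 \<Longrightarrow>
      1 \<le> growth_ratio t m k \<and>
      1 / growth_ratio t m k \<le> 1 - log_increment t m k + K / (real t + 1)\<^sup>2"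
    using growth_ratio_bounds by metis
  show ?thesis
  proof (rule that[OF K])
    fix t g assume g: "reachable t g"
    define m C w where "m = real (card (edges g))" and "C = real (num_triples g)" and "w = normalisation t g"
    define \<kappa> where "\<kappa> = K / (real t + 1)\<^sup>2"
    let ?z = "log_increment t m" and ?\<rho> = "growth_ratio t m"
    define Q1 Q2 where "Q1 = mean_degree_gain t g" and "Q2 = mean_edge_gain g"
    have m: "real t + 1 \<le> m" using edges_lower[OF g] by (simp add: m_def)
    have w: "0 < w" using normalisation_pos[OF g] by (simp add: w_def)
    have C: "0 \<le> C" by (simp add: C_def)
    note norm_next = normalisation_next[OF g, folded m_def w_def]
    note Q = mean_gain_nonneg[OF g, folded Q1_def Q2_def]
    have bound: "(C + Q) / ?\<rho> k \<le> C * (1 - ?z k + \<kappa>) + Q" if "k = 1 \<or> k = 2" "0 \<le> Q" for k Q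
    proof -
      note r = ratio[OF m that(1), folded \<kappa>_def]
      have "C * (1 / ?\<rho> k) \<le> C * (1 - ?z k + \<kappa>)" using r C by (intro mult_left_mono) auto
      moreover have "Q / ?\<rho> k \<le> Q / 1" using r that by (intro divide_left_mono) auto
      ultimately show ?thesis by (simp add: add_divide_distrib)
    qed
    have "(\<Sum>u\<in>verts g. attach_prob \<delta> t g u *
          (real (num_triples (join_edge (t + 3) g {u})) / normalisation (Suc t) (join_edge (t + 3) g {u})))
        = (\<Sum>u\<in>verts g. C * attach_prob \<delta> t g u + attach_prob \<delta> t g u * real (degree g u)) / (w * ?\<rho> 1)"
      unfolding sum_divide_distrib
      using vertex_attachment_counts(3)[OF g]
      by (intro sum.cong refl) (simp add: norm_next C_def algebra_simps add_divide_distrib)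
    also have "\<dots> = (C + Q1) / ?\<rho> 1 / w"
      using sum_attach_prob[OF g]
      by (simp add: sum.distrib Q1_def mean_degree_gain_def mult.commute flip: sum_distrib_left)
    finally have vertex: "(\<Sum>u\<in>verts g. attach_prob \<delta> t g u *
          (real (num_triples (join_edge (t + 3) g {u})) / normalisation (Suc t) (join_edge (t + 3) g {u})))
        = (C + Q1) / ?\<rho> 1 / w" .
    have "(\<Sum>e\<in>edges g. 1 / real (card (edges g)) *
          (real (num_triples (join_edge (t + 3) g e)) / normalisation (Suc t) (join_edge (t + 3) g e)))
        = (\<Sum>e\<in>edges g. C * (1 / real (card (edges g)))
            + 1 / real (card (edges g)) * (real (\<Sum>v\<in>e. degree g v) + 1)) / (w * ?\<rho> 2)"
      unfolding sum_divide_distrib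
      using edge_attachment_counts(3)[OF g]
      by (intro sum.cong refl) (simp add: norm_next C_def algebra_simps add_divide_distrib)
    also have "\<dots> = (C + Q2) / ?\<rho> 2 / w"
      unfolding sum.distrib sum_distrib_left[symmetric] sum_edges_uniform[OF g] Q2_def mean_edge_gain_def
      by (simp add: mult.commute)
    finally have edge: "(\<Sum>e\<in>edges g. 1 / real (card (edges g)) *
          (real (num_triples (join_edge (t + 3) g e)) / normalisation (Suc t) (join_edge (t + 3) g e)))
        = (C + Q2) / ?\<rho> 2 / w" .
    have "step_mean \<alpha> \<delta> t (\<lambda>h. real (num_triples h) / normalisation (Suc t) h) g
        = ((1 - \<alpha>) * ((C + Q1) / ?\<rho> 1) + \<alpha> * ((C + Q2) / ?\<rho> 2)) / w"
      unfolding step_mean_def vertex edge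
      by (simp only: add_divide_distrib[of _ _ w] times_divide_eq_right)
    also have "\<dots> \<le> ((1 - \<alpha>) * (C * (1 - ?z 1 + \<kappa>) + Q1) + \<alpha> * (C * (1 - ?z 2 + \<kappa>) + Q2)) / w"
      using w alpha_pos alpha_le_1 Q by (intro divide_right_mono add_mono mult_left_mono bound) auto
    also have "\<dots> = (C * (1 + \<kappa>) + (((1 - \<alpha>) * Q1 + \<alpha> * Q2)
        - ((1 - \<alpha>) * ?z 1 + \<alpha> * ?z 2) * C)) / w"
      by (simp add: algebra_simps)
    also have "\<dots> \<le> (C * (1 + \<kappa>) + 7) / w"
      using w mean_gain_bounds(2)[OF g, folded m_def C_def Q1_def Q2_def]
      by (intro divide_right_mono) auto
    finally show "step_mean \<alpha> \<delta> t (\<lambda>h. real (num_triples h) / normalisation (Suc t) h) g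
        \<le> real (num_triples g) / normalisation t g * (1 + K / (real t + 1)\<^sup>2) + 7 / normalisation t g"
      by (simp add: C_def w_def \<kappa>_def add_divide_distrib)
  qed
qed

text \<open>The relative mean increments are of order \<open>1 / (t + 1)\<close> because \<open>t \<le> C\<close>; multiplied by \<open>1 / \<surd>C\<close> they
  become summable.\<close>

lemma mean_gain_relative_bound:
  assumes g: "reachable t g" and t: "1 \<le> t"
  defines "C \<equiv> real (num_triples g)" and "B \<equiv> 8 + 8 / (1 + \<delta>)"
  shows "mean_degree_gain t g / C \<le> B / (real t + 1)" "mean_edge_gain g / C \<le> B / (real t + 1)"
    and "1 / sqrt C \<le> 2 / sqrt (real t + 1)"
proof -
  define m s where "m = real (card (edges g))" and "s = real t + 1"
  note counts = reachable_counts[OF g]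
  have m: "s \<le> m" "m \<le> 3 * C" using counts t by (auto simp: m_def s_def C_def)
  have C: "1 \<le> C" "s \<le> 2 * C" using counts t by (auto simp: s_def C_def)
  have s: "1 \<le> s" by (simp add: s_def)
  note D = total_weight_lower[OF m(1)[unfolded s_def], folded s_def]
  have "2 * (1 + \<delta>) * m \<le> 6 * (1 + \<delta>) * C"
    using mult_left_mono[OF m(2), of "2 * (1 + \<delta>)"] delta_gt by (simp add: algebra_simps)
  then have "mean_degree_gain t g \<le> (2 * C + 6 * (1 + \<delta>) * C) / total_weight t m"
    unfolding mean_degree_gain_eq[OF g] C_def[symmetric] m_def[symmetric]
    using D by (intro divide_right_mono add_left_mono) auto
  also have "\<dots> \<le> (2 * C + 6 * (1 + \<delta>) * C) / ((1 + \<delta>) * s)"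
    using D C s delta_gt by (intro divide_left_mono) (auto intro!: mult_pos_pos add_nonneg_nonneg mult_nonneg_nonneg)
  also have "\<dots> = C * ((6 + 2 / (1 + \<delta>)) / s)" using delta_gt s by (simp add: field_simps)
  also have "\<dots> \<le> C * (B / s)" unfolding B_def
    using C s delta_gt by (intro mult_left_mono divide_right_mono add_mono) auto
  finally show "mean_degree_gain t g / C \<le> B / (real t + 1)"
    using C by (simp add: s_def pos_divide_le_eq mult.commute)
  have "mean_edge_gain g / C = 2 / m + 3 / C"
    unfolding mean_edge_gain_eq[OF g] C_def[symmetric] m_def[symmetric]
    using C m s by (simp add: field_simps)
  also have "\<dots> \<le> 2 / s + 3 / (s / 2)" using C m s by (intro add_mono divide_left_mono) auto
  also have "\<dots> = 8 / s" by simp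
  also have "\<dots> \<le> B / s" using s delta_gt by (intro divide_right_mono) (auto simp: B_def)
  finally show "mean_edge_gain g / C \<le> B / (real t + 1)" by (simp add: s_def)
  have "sqrt s \<le> sqrt (4 * C)" using C by (intro real_sqrt_le_mono) auto
  then have "sqrt s \<le> 2 * sqrt C" by (simp add: real_sqrt_mult)
  then show "1 / sqrt C \<le> 2 / sqrt (real t + 1)"
    using C s unfolding s_def[symmetric] by (simp add: field_simps)
qed

text \<open>Expanding \<open>1 / (C + d)\<close> to first order makes the growth rate of the scale cancel again, and the remainder
  of the mean increment of \<open>C\<close> gives the negative term. The second-order term is at most
  \<open>7 / \<surd>C\<close> times the first-order one, of order \<open>(t + 1) powr (- 3/2)\<close>.\<close>

lemma inverse_triples_drift:
  obtains K where "0 \<le> K"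
    and "\<And>t g. reachable t g \<Longrightarrow> 1 \<le> t \<Longrightarrow>
      step_mean \<alpha> \<delta> t (\<lambda>h. normalisation (Suc t) h / real (num_triples h)) g
        \<le> normalisation t g / real (num_triples g) * (1 + K * (real t + 1) powr (- (3/2)))
          - 3 * \<alpha> * normalisation t g / (real (num_triples g))\<^sup>2"
proof -
  obtain R where R: "0 \<le> R"
    and ratio: "\<And>t m k. real t + 1 \<le> m \<Longrightarrow> k = 1 \<or> k = 2 \<Longrightarrow>
      1 \<le> growth_ratio t m k \<and> growth_ratio t m k \<le> R \<and>
      growth_ratio t m k \<le> 1 + log_increment t m k + R / (real t + 1)\<^sup>2"
    using growth_ratio_bounds by metis
  define B where "B = 8 + 8 / (1 + \<delta>)"
  define K where "K = R + R * (14 * B)"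
  have B: "0 \<le> B" using delta_gt by (simp add: B_def)
  show ?thesis
  proof (rule that)
    show "0 \<le> K" using R B by (simp add: K_def)
    fix t g assume g: "reachable t g" and t: "1 \<le> t"
    define m C w where "m = real (card (edges g))" and "C = real (num_triples g)" and "w = normalisation t g"
    define \<epsilon> where "\<epsilon> = (real t + 1) powr (- (3/2))"
    let ?z = "log_increment t m" and ?\<rho> = "growth_ratio t m"
    define Q1 Q2 where "Q1 = mean_degree_gain t g" and "Q2 = mean_edge_gain g"
    have m: "real t + 1 \<le> m" using edges_lower[OF g] by (simp add: m_def)
    have w: "0 < w" using normalisation_pos[OF g] by (simp add: w_def)
    have C: "1 \<le> C" using reachable_counts[OF g] t by (simp add: C_def)
    have sg: "simple_graph g" using reachable_simple_verts[OF g] by simp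
    note norm_next = normalisation_next[OF g, folded m_def w_def]
    note Q = mean_gain_nonneg[OF g, folded Q1_def Q2_def]
    note rel = mean_gain_relative_bound[OF g t, folded C_def Q1_def Q2_def B_def]
    have deg: "real (degree g v) \<le> 3 * sqrt C" if "v \<in> verts g" for v
      using degree_bound[OF sg that] C by (simp add: C_def)
    have eps: "\<epsilon> = 1 / ((real t + 1) * sqrt (real t + 1))" "0 < \<epsilon>"
      using powr_add[of "real t + 1" 1 "1/2"] by (simp_all add: \<epsilon>_def powr_minus_divide powr_half_sqrt)
    have eps2: "R / (real t + 1)\<^sup>2 \<le> R * \<epsilon>"
    proof -
      have "(real t + 1) powr (- 2) \<le> \<epsilon>" unfolding \<epsilon>_def by (intro powr_mono) auto
      then have "R * (real t + 1) powr (- 2) \<le> R * \<epsilon>" using R by (rule mult_left_mono)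
      then show ?thesis by (simp add: powr_minus_divide)
    qed
    have second: "7 / sqrt C * (Q / C) \<le> 14 * B * \<epsilon>" if "Q / C \<le> B / (real t + 1)" "0 \<le> Q" for Q
    proof -
      have "7 * (1 / sqrt C) * (Q / C) \<le> 7 * (2 / sqrt (real t + 1)) * (B / (real t + 1))"
        using rel(3) that C by (intro mult_mono) auto
      also have "\<dots> = 14 * B * \<epsilon>" by (simp add: eps mult_ac)
      finally show ?thesis by simp
    qed
    \<comment> \<open>The scale grows, so that dropping the factor \<open>?\<rho> k\<close> in front of the negative first-order term is allowed.\<close>
    have bound: "?\<rho> k * (1 - Q / C + 7 / sqrt C * (Q / C)) \<le> 1 + ?z k - Q / C + K * \<epsilon>"
      if k: "k = 1 \<or> k = 2" and Qk: "Q / C \<le> B / (real t + 1)" "0 \<le> Q" for k Q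
    proof -
      note r = ratio[OF m k]
      define x where "x = Q / C"
      have x: "0 \<le> x" using Qk C by (simp add: x_def)
      have "?\<rho> k * (7 / sqrt C * x) \<le> R * (14 * B * \<epsilon>)"
        using r second[OF Qk, folded x_def] x C R by (intro mult_mono[OF _ second[OF Qk, folded x_def]]) auto
      moreover have "1 * x \<le> ?\<rho> k * x" using r x by (intro mult_right_mono) auto
      moreover have "?\<rho> k * (1 - x + 7 / sqrt C * x) = ?\<rho> k - ?\<rho> k * x + ?\<rho> k * (7 / sqrt C * x)"
        by (simp add: algebra_simps)
      ultimately have "?\<rho> k * (1 - x + 7 / sqrt C * x) \<le> 1 + ?z k + R * \<epsilon> - x + R * (14 * B * \<epsilon>)"
        using r eps2 by linarith
      then show ?thesis by (simp add: K_def x_def algebra_simps)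
    qed
    have vertex_le: "(\<Sum>u\<in>verts g. attach_prob \<delta> t g u *
          (normalisation (Suc t) (join_edge (t + 3) g {u}) / real (num_triples (join_edge (t + 3) g {u}))))
        \<le> w / C * (?\<rho> 1 * (1 - Q1 / C + 7 / sqrt C * (Q1 / C)))"
    proof -
      have "(\<Sum>u\<in>verts g. attach_prob \<delta> t g u *
          (normalisation (Suc t) (join_edge (t + 3) g {u}) / real (num_triples (join_edge (t + 3) g {u}))))
        \<le> (\<Sum>u\<in>verts g. attach_prob \<delta> t g u * (w * ?\<rho> 1 *
            ((1 - real (degree g u) / C + 7 / sqrt C * (real (degree g u) / C)) / C)))"
      proof (intro sum_mono mult_left_mono)
        fix u assume u: "u \<in> verts g"
        have "real (degree g u) \<le> 7 * sqrt C" using deg[OF u] C by (smt (verit) real_sqrt_ge_0_iff)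
        then have "1 / (C + real (degree g u))
            \<le> (1 - real (degree g u) / C + 7 / sqrt C * (real (degree g u) / C)) / C"
          using C by (intro inverse_increment_le) auto
        then have "w * ?\<rho> 1 * (1 / (C + real (degree g u)))
            \<le> w * ?\<rho> 1 * ((1 - real (degree g u) / C + 7 / sqrt C * (real (degree g u) / C)) / C)"
          using w ratio[OF m, of 1] by (intro mult_left_mono) auto
        then show "normalisation (Suc t) (join_edge (t + 3) g {u}) / real (num_triples (join_edge (t + 3) g {u}))
            \<le> w * ?\<rho> 1 * ((1 - real (degree g u) / C + 7 / sqrt C * (real (degree g u) / C)) / C)"
          using vertex_attachment_counts(3)[OF g u] u by (simp add: norm_next C_def)
      qed (use attach_prob_nonneg[OF g] in auto)
      also have "\<dots> = (\<Sum>u\<in>verts g. w / C * ?\<rho> 1 * (attach_prob \<delta> t g u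
          + (7 / sqrt C - 1) / C * (attach_prob \<delta> t g u * real (degree g u))))"
        using C by (intro sum.cong refl) (simp add: field_simps)
      also have "\<dots> = w / C * ?\<rho> 1 * (1 + (7 / sqrt C - 1) / C * Q1)"
        unfolding sum_distrib_left[symmetric] sum.distrib sum_attach_prob[OF g]
          Q1_def mean_degree_gain_def ..
      also have "\<dots> = w / C * (?\<rho> 1 * (1 - Q1 / C + 7 / sqrt C * (Q1 / C)))"
        using C by (simp add: field_simps)
      finally show ?thesis .
    qed
    have edge_le: "(\<Sum>e\<in>edges g. 1 / real (card (edges g)) *
          (normalisation (Suc t) (join_edge (t + 3) g e) / real (num_triples (join_edge (t + 3) g e))))
        \<le> w / C * (?\<rho> 2 * (1 - Q2 / C + 7 / sqrt C * (Q2 / C)))"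
    proof -
      define s where "s e = real (\<Sum>v\<in>e. degree g v) + 1" for e
      have "(\<Sum>e\<in>edges g. 1 / real (card (edges g)) *
          (normalisation (Suc t) (join_edge (t + 3) g e) / real (num_triples (join_edge (t + 3) g e))))
        \<le> (\<Sum>e\<in>edges g. 1 / real (card (edges g)) * (w * ?\<rho> 2 *
            ((1 - s e / C + 7 / sqrt C * (s e / C)) / C)))"
      proof (intro sum_mono mult_left_mono)
        fix e assume e: "e \<in> edges g"
        have ev: "e \<subseteq> verts g" "card e = 2" using sg e by (auto simp: simple_graph_def)
        have "(\<Sum>v\<in>e. real (degree g v)) \<le> (\<Sum>v\<in>e. 3 * sqrt C)" using deg ev by (intro sum_mono) auto
        then have "s e \<le> 7 * sqrt C" using ev C by (simp add: s_def) (smt (verit) real_sqrt_ge_1_iff)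
        moreover have "0 \<le> s e" by (simp add: s_def add_nonneg_nonneg sum_nonneg)
        ultimately have "1 / (C + s e) \<le> (1 - s e / C + 7 / sqrt C * (s e / C)) / C"
          using C by (intro inverse_increment_le) auto
        then have "w * ?\<rho> 2 * (1 / (C + s e))
            \<le> w * ?\<rho> 2 * ((1 - s e / C + 7 / sqrt C * (s e / C)) / C)"
          using w ratio[OF m, of 2] by (intro mult_left_mono) auto
        moreover have "real (num_triples (join_edge (t + 3) g e)) = C + s e"
          using edge_attachment_counts(3)[OF g e] by (simp add: C_def s_def)
        ultimately show "normalisation (Suc t) (join_edge (t + 3) g e) / real (num_triples (join_edge (t + 3) g e))
            \<le> w * ?\<rho> 2 * ((1 - s e / C + 7 / sqrt C * (s e / C)) / C)"
          using norm_next(2)[OF e] by simp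
      qed auto
      also have "\<dots> = (\<Sum>e\<in>edges g. w / C * ?\<rho> 2 * (1 / real (card (edges g))
          + (7 / sqrt C - 1) / C * (1 / real (card (edges g)) * s e)))"
      proof -
        have "p * (w * r * ((1 - x / C + 7 / sqrt C * (x / C)) / C))
            = w / C * r * (p + (7 / sqrt C - 1) / C * (p * x))" for p r x
          using C by (simp add: field_simps)
        then show ?thesis by (intro sum.cong refl)
      qed
      also have "\<dots> = w / C * ?\<rho> 2 * (1 + (7 / sqrt C - 1) / C * Q2)"
        unfolding sum_distrib_left[symmetric] sum.distrib sum_edges_uniform[OF g]
          Q2_def mean_edge_gain_def s_def ..
      also have "\<dots> = w / C * (?\<rho> 2 * (1 - Q2 / C + 7 / sqrt C * (Q2 / C)))"
        using C by (simp add: field_simps)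
      finally show ?thesis .
    qed
    have "step_mean \<alpha> \<delta> t (\<lambda>h. normalisation (Suc t) h / real (num_triples h)) g
        \<le> (1 - \<alpha>) * (w / C * (?\<rho> 1 * (1 - Q1 / C + 7 / sqrt C * (Q1 / C))))
          + \<alpha> * (w / C * (?\<rho> 2 * (1 - Q2 / C + 7 / sqrt C * (Q2 / C))))"
      unfolding step_mean_def
      using alpha_pos alpha_le_1 by (intro add_mono mult_left_mono vertex_le edge_le) auto
    also have "\<dots> \<le> (1 - \<alpha>) * (w / C * (1 + ?z 1 - Q1 / C + K * \<epsilon>))
          + \<alpha> * (w / C * (1 + ?z 2 - Q2 / C + K * \<epsilon>))"
      using alpha_pos alpha_le_1 w C rel Q by (intro add_mono mult_left_mono bound) auto
    also have "\<dots> = w / C * (1 + K * \<epsilon>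
        + ((1 - \<alpha>) * ?z 1 + \<alpha> * ?z 2) - ((1 - \<alpha>) * Q1 + \<alpha> * Q2) / C)"
      using C by (simp add: field_simps)
    also have "\<dots> \<le> w / C * (1 + K * \<epsilon> - 3 * \<alpha> / C)"
    proof (rule mult_left_mono)
      define rate gain where "rate = (1 - \<alpha>) * ?z 1 + \<alpha> * ?z 2" and "gain = (1 - \<alpha>) * Q1 + \<alpha> * Q2"
      have "rate * C + 3 * \<alpha> \<le> gain"
        using mean_gain_bounds(1)[OF g, folded m_def C_def Q1_def Q2_def] by (simp add: rate_def gain_def)
      then have "(rate * C + 3 * \<alpha>) / C \<le> gain / C" using C by (intro divide_right_mono) auto
      then have "rate + 3 * \<alpha> / C \<le> gain / C" using C by (simp add: add_divide_distrib)
      then show "1 + K * \<epsilon> + rate - gain / C \<le> 1 + K * \<epsilon> - 3 * \<alpha> / C" by simp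
    qed (use w C in auto)
    also have "\<dots> = w / C * (1 + K * \<epsilon>) - 3 * \<alpha> * w / C\<^sup>2"
      by (simp add: power2_eq_square right_diff_distrib)
    finally show "step_mean \<alpha> \<delta> t (\<lambda>h. normalisation (Suc t) h / real (num_triples h)) g
        \<le> normalisation t g / real (num_triples g) * (1 + K * (real t + 1) powr (- (3/2)))
          - 3 * \<alpha> * normalisation t g / (real (num_triples g))\<^sup>2"
      by (simp add: C_def w_def \<epsilon>_def)
  qed
qed

end

section \<open>Recursive inequalities and partial sums\<close>

text \<open>A discrete Gronwall inequality.\<close>

lemma recursion_bound:
  fixes x \<epsilon> \<beta> :: "nat \<Rightarrow> real"
  assumes step: "\<And>t. x (Suc t) \<le> x t * (1 + \<epsilon> t) + \<beta> t"
    and eps: "\<And>t. 0 \<le> \<epsilon> t" and beta: "\<And>t. 0 \<le> \<beta> t" and x0: "0 \<le> x 0"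
  shows "x t \<le> exp (\<Sum>s<t. \<epsilon> s) * (x 0 + (\<Sum>s<t. \<beta> s))"
proof (induction t)
  case 0
  show ?case by simp
next
  case (Suc t)
  define P where "P = exp (\<Sum>s<t. \<epsilon> s)"
  define S where "S = x 0 + (\<Sum>s<t. \<beta> s)"
  have P: "1 \<le> P" and S: "0 \<le> S"
    using eps beta x0 by (auto simp: P_def S_def sum_nonneg)
  have "x (Suc t) \<le> P * S * (1 + \<epsilon> t) + \<beta> t"
  proof -
    have "x t * (1 + \<epsilon> t) \<le> P * S * (1 + \<epsilon> t)"
      using Suc eps[of t] by (intro mult_right_mono) (auto simp: P_def S_def)
    then show ?thesis using step[of t] by linarith
  qed
  also have "\<dots> \<le> P * S * exp (\<epsilon> t) + P * exp (\<epsilon> t) * \<beta> t"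
  proof (rule add_mono)
    show "P * S * (1 + \<epsilon> t) \<le> P * S * exp (\<epsilon> t)"
      using P S by (intro mult_left_mono exp_ge_add_one_self) auto
    have "1 \<le> P * exp (\<epsilon> t)" using P eps[of t] mult_mono[of 1 P 1 "exp (\<epsilon> t)"] by simp
    then show "\<beta> t \<le> P * exp (\<epsilon> t) * \<beta> t" using beta[of t] mult_right_mono by fastforce
  qed
  also have "\<dots> = exp (\<Sum>s<Suc t. \<epsilon> s) * (x 0 + (\<Sum>s<Suc t. \<beta> s))"
    by (simp add: P_def S_def exp_add algebra_simps)
  finally show ?case .
qed

text \<open>Dividing by the product of the factors \<open>1 + \<epsilon>\<close> (bounded above through \<open>exp\<close>) gives a sequence \<open>z\<close> with
  \<open>z (t + 1) \<le> z t - c' (z t)\<^sup>2 / (t + 1)\<close>. Such a sequence decreases, and hence \<open>1 / z\<close> grows by at least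
  \<open>c' / (t + 1)\<close> in every step.\<close>

lemma logistic_recursion_bound:
  fixes y \<epsilon> :: "nat \<Rightarrow> real"
  assumes step: "\<And>t. y (Suc t) \<le> y t * (1 + \<epsilon> t) - c / (real t + 1) * (y t)\<^sup>2"
    and eps: "\<And>t. 0 \<le> \<epsilon> t" and bound: "\<And>t. (\<Sum>s<t. \<epsilon> s) \<le> B"
    and y: "\<And>t. 0 < y t" and c: "0 < c"
  shows "y t * harm t \<le> exp (2 * B) / c"
proof -
  define P where "P t = exp (\<Sum>s<t. \<epsilon> s)" for t
  define z where "z t = y t / P t" for t
  define c' where "c' = c * exp (- B)"
  have P: "1 \<le> P t" "P t \<le> exp B" for t
    using eps bound[of t] by (auto simp: P_def sum_nonneg)
  have P0: "0 < P t" for t by (simp add: P_def)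
  have z: "0 < z t" for t using y[of t] P0[of t] by (simp add: z_def)
  have c': "0 < c'" using c by (simp add: c'_def)
  have dec: "z (Suc t) \<le> z t - c' / (real t + 1) * (z t)\<^sup>2" for t
  proof -
    have PS: "P t * (1 + \<epsilon> t) \<le> P (Suc t)"
      using P0[of t] by (simp add: P_def exp_add)
    have yz: "y t = z t * P t" using P0[of t] by (simp add: z_def)
    have "c' * P (Suc t) \<le> c * 1"
      using P(2)[of "Suc t"] c by (simp add: c'_def exp_minus field_simps)
    also have "\<dots> \<le> c * (P t)\<^sup>2" using c P(1)[of t] by (intro mult_left_mono) auto
    finally have "c' * P (Suc t) / (real t + 1) * (z t)\<^sup>2 \<le> c * (P t)\<^sup>2 / (real t + 1) * (z t)\<^sup>2"
      by (intro mult_right_mono divide_right_mono) auto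
    moreover have "z t * (P t * (1 + \<epsilon> t)) \<le> z t * P (Suc t)"
      using PS z[of t] by (intro mult_left_mono) auto
    ultimately have "y (Suc t) \<le> (z t - c' / (real t + 1) * (z t)\<^sup>2) * P (Suc t)"
      using step[of t] unfolding yz by (simp add: algebra_simps power2_eq_square)
    then show ?thesis using P0[of "Suc t"] by (simp add: z_def pos_divide_le_eq)
  qed
  have grow: "c' * harm t \<le> 1 / z t" for t
  proof (induction t)
    case 0
    then show ?case using z[of 0] by (simp add: harm_def)
  next
    case (Suc t)
    have "z (Suc t) \<le> z t" using dec[of t] c' by (smt (verit) divide_nonneg_nonneg mult_nonneg_nonneg of_nat_0_le_iff zero_le_power2)
    then have "c' / (real t + 1) * z t * z (Suc t) \<le> c' / (real t + 1) * z t * z t"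
      using c' z[of t] by (intro mult_left_mono) auto
    also have "\<dots> \<le> z t - z (Suc t)"
      using dec[of t] by (simp add: power2_eq_square mult.assoc)
    finally have "c' / (real t + 1) \<le> (z t - z (Suc t)) / (z t * z (Suc t))"
      using z[of t] z[of "Suc t"] by (simp add: pos_le_divide_eq mult.assoc)
    also have "\<dots> = 1 / z (Suc t) - 1 / z t"
      using z[of t] z[of "Suc t"] by (simp add: field_simps)
    finally have "c' * harm t + c' / (real t + 1) \<le> 1 / z (Suc t)" using Suc by linarith
    then show ?case by (simp add: harm_Suc distrib_left divide_inverse add.commute)
  qed
  have "c' * harm t * z t \<le> 1" using grow[of t] z[of t] by (simp add: pos_le_divide_eq)
  then have "z t * harm t \<le> exp B / c"
    using c by (simp add: c'_def exp_minus field_simps)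
  then have "P t * (z t * harm t) \<le> exp B * (exp B / c)"
    using P[of t] z[of t] harm_nonneg[of t, where ?'a = real] by (intro mult_mono) auto
  then show ?thesis using P0[of t] by (simp add: z_def exp_double power2_eq_square)
qed

text \<open>Concavity of \<open>x powr (1 - p)\<close>, in the form \<open>(1 - x) powr q \<le> 1 - q x\<close>, makes each summand at most a
  difference of consecutive values of \<open>s powr (1 - p) / (1 - p)\<close>.\<close>

lemma sum_powr_subcritical:
  fixes p :: real
  assumes "0 < p" "p < 1"
  shows "(\<Sum>s<t. (real s + 1) powr (- p)) \<le> real t powr (1 - p) / (1 - p)"
proof (induction t)
  case 0
  then show ?case by simp
next
  case (Suc t)
  define q where "q = 1 - p"
  have q: "0 < q" "q < 1" using assms by (auto simp: q_def)
  have "real t powr q / (real t + 1) powr q \<le> 1 - q / (real t + 1)"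
  proof (cases "t = 0")
    case True
    then show ?thesis using q by simp
  next
    case False
    define x where "x = 1 / (real t + 1)"
    have x: "0 < x" "x < 1" using False by (auto simp: x_def field_simps)
    have one_minus_x: "1 - x = real t / (real t + 1)" by (simp add: x_def field_simps)
    have "exp (q * ln (1 - x) + (1 - q) * ln 1) \<le> q * exp (ln (1 - x)) + (1 - q) * exp (ln 1)"
      using q convex_onD[OF exp_convex, of "1 - q" "ln (1 - x)" "ln 1"] by (simp add: algebra_simps)
    then have "(1 - x) powr q \<le> 1 - q * x" using x by (simp add: powr_def algebra_simps)
    then show ?thesis unfolding one_minus_x using False by (simp add: powr_divide x_def)
  qed
  then have "real t powr q \<le> (1 - q / (real t + 1)) * (real t + 1) powr q"
    by (subst (asm) pos_divide_le_eq) auto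
  also have "\<dots> = (real t + 1) powr q - q * (real t + 1) powr (- p)"
    using powr_diff[of "real t + 1" q 1] by (simp add: q_def algebra_simps)
  finally have "(real t + 1) powr (- p) \<le> (real t + 1) powr q / q - real t powr q / q"
    using q by (simp add: field_simps)
  then show ?case using Suc by (simp add: q_def add.commute)
qed

lemma sum_powr_supercritical:
  fixes p :: real
  assumes "1 < p"
  obtains B where "0 \<le> B" "\<And>t. (\<Sum>s<t. (real s + 1) powr (- p)) \<le> B"
proof -
  have "summable (\<lambda>s. real s powr (- p))" using assms by (simp add: summable_real_powr_iff)
  then have sm: "summable (\<lambda>s. (real s + 1) powr (- p))"
    using summable_Suc_iff[of "\<lambda>s. real s powr (- p)"] by (simp add: add.commute)
  show ?thesis
  proof
    show "0 \<le> (\<Sum>s. (real s + 1) powr (- p))" using sm by (intro suminf_nonneg) auto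
    show "(\<Sum>s<t. (real s + 1) powr (- p)) \<le> (\<Sum>s. (real s + 1) powr (- p))" for t
      using sm by (intro sum_le_suminf) auto
  qed
qed

lemma sum_powr_critical: "(\<Sum>s<t. (real s + 1) powr (- 1)) = harm t"
  by (induction t) (auto simp: harm_Suc powr_minus add.commute harm_def)

lemma harm_le_ln: "1 \<le> t \<Longrightarrow> harm t \<le> 1 + ln (real t)"
proof -
  assume "1 \<le> t"
  then obtain n where t: "t = Suc n" using not0_implies_Suc by fastforce
  have "harm (Suc n) - ln (real (Suc n)) \<le> harm (Suc 0) - ln (real (Suc 0))"
    using decseq_harm_diff_ln unfolding decseq_def by blast
  then show ?thesis by (simp add: t harm_def)
qed

lemma bigtheta_sandwich:
  fixes f h :: "nat \<Rightarrow> real"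
  assumes "0 < c" and h: "eventually (\<lambda>t. 0 \<le> h t) sequentially"
    and lower: "eventually (\<lambda>t. c * h t \<le> f t) sequentially"
    and upper: "eventually (\<lambda>t. f t \<le> C * h t) sequentially"
  shows "f \<in> \<Theta>(h)"
proof (rule bigthetaI)
  show "f \<in> O(h)"
  proof (rule bigoI)
    show "eventually (\<lambda>t. norm (f t) \<le> C * norm (h t)) sequentially"
      using h lower upper
    proof eventually_elim
      case (elim t)
      then have "0 \<le> c * h t" using assms(1) by simp
      then show ?case using elim by simp
    qed
  qed
  show "f \<in> \<Omega>(h)"
    by (rule landau_omega.bigI[OF assms(1)]) (use h lower in \<open>eventually_elim; simp\<close>)
qed

section \<open>Expected clustering coefficient\<close>

context clustering_process begin

lemma mean_triangles: "expectation (\<lambda>\<omega>. real (num_triangles (G t \<omega>))) = \<alpha> * real t"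
proof (induction t)
  case 0
  then show ?case using expectation_initial[of "\<lambda>g. real (num_triangles g)"] counts_initial by simp
next
  case (Suc t)
  have step: "step_mean \<alpha> \<delta> t (\<lambda>h. real (num_triangles h)) g = real (num_triangles g) + \<alpha>"
    if g: "reachable t g" for g
  proof -
    have "step_mean \<alpha> \<delta> t (\<lambda>h. real (num_triangles h)) g
        = (1 - \<alpha>) * ((\<Sum>u\<in>verts g. attach_prob \<delta> t g u) * real (num_triangles g))
          + \<alpha> * ((\<Sum>e\<in>edges g. 1 / real (card (edges g))) * (real (num_triangles g) + 1))"
      unfolding step_mean_def sum_distrib_right
      using vertex_attachment_counts(2)[OF g] edge_attachment_counts(2)[OF g] by simp
    then show ?thesis
      unfolding sum_attach_prob[OF g] sum_edges_uniform[OF g] by (simp add: algebra_simps)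
  qed
  have "expectation (\<lambda>\<omega>. real (num_triangles (G (Suc t) \<omega>)))
      = expectation (\<lambda>\<omega>. step_mean \<alpha> \<delta> t (\<lambda>h. real (num_triangles h)) (G t \<omega>))"
    by (rule expectation_step[of "\<lambda>h. real (num_triangles h)"])
  also have "\<dots> = expectation (\<lambda>\<omega>. real (num_triangles (G t \<omega>)) + \<alpha>)"
    by (intro integral_cong_AE) (use AE_reachable[of t] in \<open>auto simp: step\<close>)
  also have "\<dots> = expectation (\<lambda>\<omega>. real (num_triangles (G t \<omega>))) + \<alpha>"
    using integrable_G[of "\<lambda>g. real (num_triangles g)" t] by (simp add: prob_space)
  finally show ?case using Suc by (simp add: algebra_simps)
qed

text \<open>The sum is of order \<open>t powr (1 - p)\<close>, \<open>ln t\<close> or 1 according to whether the growth exponent \<open>p\<close> is below, equal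
  to or above 1.\<close>

lemma mean_triples_upper:
  obtains K where "0 < K"
    and "\<And>t. expectation (\<lambda>\<omega>. real (num_triples (G t \<omega>)))
      \<le> K * (real t + 1) powr growth_exponent * (\<Sum>s<t. (real s + 1) powr (- growth_exponent))"
proof -
  obtain K where K: "0 \<le> K"
    and drift: "\<And>t g. reachable t g \<Longrightarrow>
      step_mean \<alpha> \<delta> t (\<lambda>h. real (num_triples h) / normalisation (Suc t) h) g
        \<le> real (num_triples g) / normalisation t g * (1 + K / (real t + 1)\<^sup>2) + 7 / normalisation t g"
    using triples_drift by blast
  obtain c C where c: "0 < c" and C: "0 < C"
    and norm: "\<And>t g. reachable t g \<Longrightarrow>
      c * (real t + 1) powr growth_exponent \<le> normalisation t g \<and>
      normalisation t g \<le> C * (real t + 1) powr growth_exponent"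
    using normalisation_bounds by blast
  obtain B where B: "0 \<le> B" "\<And>t. (\<Sum>s<t. (real s + 1) powr (- 2)) \<le> B"
    using sum_powr_supercritical[of 2] by auto
  define x where "x t = expectation (\<lambda>\<omega>. real (num_triples (G t \<omega>)) / normalisation t (G t \<omega>))" for t
  define \<beta> where "\<beta> t = 7 / c * (real t + 1) powr (- growth_exponent)" for t :: nat
  have x0: "x 0 = 0"
    unfolding x_def using expectation_initial[of "\<lambda>g. real (num_triples g) / normalisation 0 g"] counts_initial
    by simp
  have "x (Suc t) \<le> x t * (1 + K / (real t + 1)\<^sup>2) + \<beta> t" for t
  proof -
    have "x (Suc t) = expectation (\<lambda>\<omega>. step_mean \<alpha> \<delta> t
        (\<lambda>h. real (num_triples h) / normalisation (Suc t) h) (G t \<omega>))"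
      unfolding x_def by (rule expectation_step[of "\<lambda>h. real (num_triples h) / normalisation (Suc t) h"])
    also have "\<dots> \<le> expectation (\<lambda>\<omega>. (1 + K / (real t + 1)\<^sup>2) *
        (real (num_triples (G t \<omega>)) / normalisation t (G t \<omega>)) + \<beta> t * 1)"
    proof (rule expectation_mono)
      fix g assume g: "reachable t g"
      have "7 / normalisation t g \<le> 7 / (c * (real t + 1) powr growth_exponent)"
        using norm[OF g] c normalisation_pos[OF g] by (intro divide_left_mono) auto
      also have "\<dots> = \<beta> t" by (simp add: \<beta>_def powr_minus_divide)
      finally show "step_mean \<alpha> \<delta> t (\<lambda>h. real (num_triples h) / normalisation (Suc t) h) g
          \<le> (1 + K / (real t + 1)\<^sup>2) * (real (num_triples g) / normalisation t g) + \<beta> t * 1"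
        using drift[OF g] by (simp add: mult.commute)
    qed
    also have "\<dots> = (1 + K / (real t + 1)\<^sup>2) * x t + \<beta> t"
      unfolding x_def
      using expectation_linear[of _ "\<lambda>g. real (num_triples g) / normalisation t g" t "\<beta> t" "\<lambda>_. 1"]
      by (simp add: prob_space)
    finally show ?thesis by (simp add: mult.commute)
  qed
  then have xb: "x t \<le> exp (\<Sum>s<t. K / (real s + 1)\<^sup>2) * (x 0 + (\<Sum>s<t. \<beta> s))" for t
    by (rule recursion_bound)
      (use K c in \<open>auto simp: \<beta>_def x0\<close>)
  define S where "S t = (\<Sum>s<t. (real s + 1) powr (- growth_exponent))" for t
  have S0: "0 \<le> S t" for t by (auto simp: S_def intro!: sum_nonneg)
  have x_le: "x t \<le> exp (K * B) * (7 / c * S t)" for t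
  proof -
    have "(\<Sum>s<t. K / (real s + 1)\<^sup>2) = K * (\<Sum>s<t. (real s + 1) powr (- 2))"
      by (simp add: sum_distrib_left powr_minus_divide)
    also have "\<dots> \<le> K * B" using K B(2) by (intro mult_left_mono) auto
    finally have "exp (\<Sum>s<t. K / (real s + 1)\<^sup>2) * (7 / c * S t) \<le> exp (K * B) * (7 / c * S t)"
      using c S0 by (intro mult_right_mono) auto
    then show ?thesis using xb[of t] by (simp add: x0 \<beta>_def S_def sum_distrib_left)
  qed
  show ?thesis
  proof (rule that)
    show "0 < C * (exp (K * B) * (7 / c))" using C c by simp
    fix t
    have "expectation (\<lambda>\<omega>. real (num_triples (G t \<omega>)))
        \<le> expectation (\<lambda>\<omega>. C * (real t + 1) powr growth_exponent *
            (real (num_triples (G t \<omega>)) / normalisation t (G t \<omega>)))"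
    proof (rule expectation_mono)
      fix g assume g: "reachable t g"
      have "normalisation t g * (real (num_triples g) / normalisation t g)
          \<le> C * (real t + 1) powr growth_exponent * (real (num_triples g) / normalisation t g)"
        using norm[OF g] normalisation_pos[OF g] by (intro mult_right_mono) auto
      then show "real (num_triples g)
          \<le> C * (real t + 1) powr growth_exponent * (real (num_triples g) / normalisation t g)"
        using normalisation_pos[OF g] by simp
    qed
    also have "\<dots> = C * (real t + 1) powr growth_exponent * x t" unfolding x_def by (rule integral_mult_right_zero)
    also have "\<dots> \<le> C * (real t + 1) powr growth_exponent * (exp (K * B) * (7 / c * S t))"
      using C by (intro mult_left_mono x_le) auto
    finally show "expectation (\<lambda>\<omega>. real (num_triples (G t \<omega>)))
      \<le> C * (exp (K * B) * (7 / c)) * (real t + 1) powr growth_exponent *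
        (\<Sum>s<t. (real s + 1) powr (- growth_exponent))"
      by (simp add: S_def mult_ac)
  qed
qed

text \<open>With \<open>T \<le> t\<close>, this is the inequality \<open>(E[T])\<^sup>2 \<le> E[T / C] E[T C]\<close>. Its proof bounds the
  convex function \<open>1 / C\<close> below by its tangent \<open>2 \<theta> - \<theta>\<^sup>2 C\<close> at \<open>C = 1 / \<theta>\<close>; the choice
  \<open>\<theta> = \<alpha> / E[C]\<close> is optimal.\<close>

lemma mean_clustering_lower:
  assumes t: "1 \<le> t" and b: "expectation (\<lambda>\<omega>. real (num_triples (G t \<omega>))) \<le> b"
  shows "3 * \<alpha>\<^sup>2 * real t / b \<le> expectation (\<lambda>\<omega>. global_clustering (G t \<omega>))"
proof -
  define m where "m = expectation (\<lambda>\<omega>. real (num_triples (G t \<omega>)))"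
  define \<theta> where "\<theta> = \<alpha> / m"
  have "expectation (\<lambda>\<omega>. real t) \<le> m"
    unfolding m_def by (rule expectation_mono[of t "\<lambda>_. real t"]) (use reachable_counts in auto)
  then have m: "0 < m" using t by (simp add: prob_space)
  have "expectation (\<lambda>\<omega>. 6 * \<theta> * real (num_triangles (G t \<omega>))
        + - (3 * \<theta>\<^sup>2 * real t) * real (num_triples (G t \<omega>)))
      \<le> expectation (\<lambda>\<omega>. global_clustering (G t \<omega>))"
  proof (rule expectation_mono)
    fix g assume g: "reachable t g"
    define T C where "T = real (num_triangles g)" and "C = real (num_triples g)"
    have T: "0 \<le> T" "T \<le> real t" and C: "0 < C"
      using reachable_counts[OF g] t by (auto simp: T_def C_def)
    have "0 \<le> (1 - \<theta> * C)\<^sup>2 / C" using C by simp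
    also have "\<dots> = 1 / C - (2 * \<theta> - \<theta>\<^sup>2 * C)" using C by (simp add: field_simps power2_eq_square)
    finally have "T * (2 * \<theta> - \<theta>\<^sup>2 * C) \<le> T * (1 / C)" using T by (intro mult_left_mono) auto
    moreover have "T * (\<theta>\<^sup>2 * C) \<le> real t * (\<theta>\<^sup>2 * C)" using T C by (intro mult_right_mono) auto
    ultimately have "3 * (T * (2 * \<theta> - \<theta>\<^sup>2 * C)) + 3 * (T * (\<theta>\<^sup>2 * C)) \<le> 3 * (T / C) + 3 * (real t * (\<theta>\<^sup>2 * C))"
      by simp
    then have "6 * \<theta> * T + - (3 * \<theta>\<^sup>2 * real t) * C \<le> 3 * T / C" by (simp add: algebra_simps)
    then show "6 * \<theta> * real (num_triangles g) + - (3 * \<theta>\<^sup>2 * real t) * real (num_triples g)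
        \<le> global_clustering g"
      by (simp add: global_clustering_def T_def C_def)
  qed
  also have "expectation (\<lambda>\<omega>. 6 * \<theta> * real (num_triangles (G t \<omega>))
        + - (3 * \<theta>\<^sup>2 * real t) * real (num_triples (G t \<omega>)))
      = 6 * \<theta> * (\<alpha> * real t) + - (3 * \<theta>\<^sup>2 * real t) * m"
    unfolding m_def mean_triangles[symmetric]
    by (rule expectation_linear[of _ "\<lambda>g. real (num_triangles g)" _ _ "\<lambda>g. real (num_triples g)"])
  also have "\<dots> = 3 * \<alpha>\<^sup>2 * real t / m"
    using m by (simp add: \<theta>_def field_simps power2_eq_square)
  finally have "3 * \<alpha>\<^sup>2 * real t / m \<le> expectation (\<lambda>\<omega>. global_clustering (G t \<omega>))" .
  moreover have "3 * \<alpha>\<^sup>2 * real t / b \<le> 3 * \<alpha>\<^sup>2 * real t / m"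
    using m b unfolding m_def[symmetric] by (intro divide_left_mono) auto
  ultimately show ?thesis by linarith
qed

text \<open>The index is shifted because the initial graph has no triples.\<close>

definition mean_inverse :: "nat \<Rightarrow> real" where
  "mean_inverse n = expectation (\<lambda>\<omega>. normalisation (Suc n) (G (Suc n) \<omega>) / real (num_triples (G (Suc n) \<omega>)))"

text \<open>Only finitely many graphs are possible at each time, so the integrand is bounded below by a positive
  constant.\<close>

lemma mean_inverse_pos: "0 < mean_inverse n"
proof -
  let ?f = "\<lambda>g. normalisation (Suc n) g / real (num_triples g)"
  define b where "b = Min (insert 1 (?f ` {g. reachable (Suc n) g}))"
  have pos: "0 < ?f g" if "reachable (Suc n) g" for g
    using normalisation_pos[OF that] reachable_counts[OF that] by simp
  have "0 < b" unfolding b_def using pos finite_reachable by (subst Min_gr_iff) auto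
  also have "b = expectation (\<lambda>\<omega>. b)" by (simp add: prob_space)
  also have "\<dots> \<le> mean_inverse n" unfolding mean_inverse_def
    by (rule expectation_mono[of "Suc n" "\<lambda>_. b" ?f])
      (use finite_reachable in \<open>auto simp: b_def intro!: Min_le\<close>)
  finally show ?thesis .
qed

text \<open>In the drift of \<open>W / C\<close> the negative term \<open>W / C\<^sup>2 = (W / C)\<^sup>2 / W\<close> is averaged with Jensen's inequality
  after replacing \<open>W\<close> by its deterministic upper bound.\<close>

lemma mean_inverse_recursion:
  obtains K c where "0 \<le> K" "0 < c"
    and "\<And>n. mean_inverse (Suc n) \<le> mean_inverse n * (1 + K * (real n + 1) powr (- (3/2)))
        - c * (real n + 2) powr (- growth_exponent) * (mean_inverse n)\<^sup>2"
proof -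
  obtain K where K: "0 \<le> K"
    and drift: "\<And>t g. reachable t g \<Longrightarrow> 1 \<le> t \<Longrightarrow>
      step_mean \<alpha> \<delta> t (\<lambda>h. normalisation (Suc t) h / real (num_triples h)) g
        \<le> normalisation t g / real (num_triples g) * (1 + K * (real t + 1) powr (- (3/2)))
          - 3 * \<alpha> * normalisation t g / (real (num_triples g))\<^sup>2"
    using inverse_triples_drift by blast
  obtain c C where c: "0 < c" and C: "0 < C"
    and norm: "\<And>t g. reachable t g \<Longrightarrow>
      c * (real t + 1) powr growth_exponent \<le> normalisation t g \<and>
      normalisation t g \<le> C * (real t + 1) powr growth_exponent"
    using normalisation_bounds by blast
  show ?thesis
  proof (rule that)
    show "0 \<le> K" "0 < 3 * \<alpha> / C" using K C alpha_pos by auto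
    fix n :: nat
    define s where "s = (real n + 2) powr growth_exponent"
    define f where "f g = normalisation (Suc n) g / real (num_triples g)" for g
    define \<epsilon> where "\<epsilon> = K * (real n + 2) powr (- (3/2))"
    have s: "0 < s" by (simp add: s_def)
    have mean: "mean_inverse n = expectation (\<lambda>\<omega>. f (G (Suc n) \<omega>))"
      by (simp add: mean_inverse_def f_def)
    have "mean_inverse (Suc n) = expectation (\<lambda>\<omega>. step_mean \<alpha> \<delta> (Suc n)
        (\<lambda>h. normalisation (Suc (Suc n)) h / real (num_triples h)) (G (Suc n) \<omega>))"
      unfolding mean_inverse_def
      by (rule expectation_step[of "\<lambda>h. normalisation (Suc (Suc n)) h / real (num_triples h)"])
    also have "\<dots> \<le> expectation (\<lambda>\<omega>. (1 + \<epsilon>) * f (G (Suc n) \<omega>) + - (3 * \<alpha> / C / s) * (f (G (Suc n) \<omega>))\<^sup>2)"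
    proof (rule expectation_mono)
      fix g assume g: "reachable (Suc n) g"
      define w where "w = normalisation (Suc n) g"
      have w: "0 < w" "w \<le> C * s"
        using norm[OF g] normalisation_pos[OF g] by (auto simp: w_def s_def add.commute)
      have "w * w \<le> C * s * w" using w by (intro mult_right_mono) auto
      then have "w\<^sup>2 / (C * s) \<le> w" using C s by (simp add: pos_divide_le_eq power2_eq_square mult_ac)
      then have "3 * \<alpha> * (w\<^sup>2 / (C * s)) / (real (num_triples g))\<^sup>2 \<le> 3 * \<alpha> * w / (real (num_triples g))\<^sup>2"
        using alpha_pos by (intro divide_right_mono mult_left_mono) auto
      moreover have "3 * \<alpha> * (w\<^sup>2 / (C * s)) / (real (num_triples g))\<^sup>2 = 3 * \<alpha> / C / s * (f g)\<^sup>2"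
        by (simp add: f_def w_def power_divide)
      moreover have "step_mean \<alpha> \<delta> (Suc n) (\<lambda>h. normalisation (Suc (Suc n)) h / real (num_triples h)) g
          \<le> f g * (1 + \<epsilon>) - 3 * \<alpha> * w / (real (num_triples g))\<^sup>2"
        using drift[OF g] by (simp add: f_def \<epsilon>_def w_def add.commute)
      ultimately show "step_mean \<alpha> \<delta> (Suc n) (\<lambda>h. normalisation (Suc (Suc n)) h / real (num_triples h)) g
          \<le> (1 + \<epsilon>) * f g + - (3 * \<alpha> / C / s) * (f g)\<^sup>2"
        by (simp add: mult.commute)
    qed
    also have "\<dots> = (1 + \<epsilon>) * mean_inverse n
        + - (3 * \<alpha> / C / s) * expectation (\<lambda>\<omega>. (f (G (Suc n) \<omega>))\<^sup>2)"
      unfolding mean by (rule expectation_linear[of _ f _ _ "\<lambda>g. (f g)\<^sup>2"])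
    also have "\<dots> \<le> (1 + \<epsilon>) * mean_inverse n - (3 * \<alpha> / C / s) * (mean_inverse n)\<^sup>2"
      using mult_left_mono[OF expectation_square_ge[of f "Suc n"], of "3 * \<alpha> / C / s"] alpha_pos C s
      by (simp add: mean)
    also have "\<dots> \<le> (1 + K * (real n + 1) powr (- (3/2))) * mean_inverse n
        - (3 * \<alpha> / C / s) * (mean_inverse n)\<^sup>2"
      unfolding \<epsilon>_def using K mean_inverse_pos[of n]
      by (intro diff_right_mono mult_right_mono add_left_mono mult_left_mono powr_mono2') auto
    finally show "mean_inverse (Suc n) \<le> mean_inverse n * (1 + K * (real n + 1) powr (- (3/2)))
        - 3 * \<alpha> / C * (real n + 2) powr (- growth_exponent) * (mean_inverse n)\<^sup>2"
      by (simp add: s_def powr_minus_divide mult.commute)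
  qed
qed

lemma mean_clustering_upper:
  obtains C where "0 < C"
    and "\<And>n. expectation (\<lambda>\<omega>. global_clustering (G (Suc n) \<omega>))
      \<le> C * (real n + 2) powr (1 - growth_exponent) * mean_inverse n"
proof -
  obtain c C where c: "0 < c" and C: "0 < C"
    and norm: "\<And>t g. reachable t g \<Longrightarrow>
      c * (real t + 1) powr growth_exponent \<le> normalisation t g \<and>
      normalisation t g \<le> C * (real t + 1) powr growth_exponent"
    using normalisation_bounds by blast
  show ?thesis
  proof (rule that)
    show "0 < 3 / c" using c by simp
    fix n :: nat
    define s where "s = (real n + 2) powr growth_exponent"
    have s: "0 < s" by (simp add: s_def)
    have split: "(real n + 2) powr (1 - growth_exponent) = (real n + 2) / s"
      by (simp add: s_def powr_diff)
    have "expectation (\<lambda>\<omega>. global_clustering (G (Suc n) \<omega>))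
        \<le> expectation (\<lambda>\<omega>. 3 / c * ((real n + 2) / s) *
            (normalisation (Suc n) (G (Suc n) \<omega>) / real (num_triples (G (Suc n) \<omega>))))"
    proof (rule expectation_mono)
      fix g assume g: "reachable (Suc n) g"
      have "1 \<le> normalisation (Suc n) g / (c * s)"
        using norm[OF g] c s by (simp add: s_def pos_le_divide_eq add.commute)
      then have "3 * real (num_triangles g) * 1 \<le> 3 * (real n + 2) * (normalisation (Suc n) g / (c * s))"
        using reachable_counts[OF g] by (intro mult_mono) auto
      then have "3 * real (num_triangles g) * 1 / real (num_triples g)
          \<le> 3 * (real n + 2) * (normalisation (Suc n) g / (c * s)) / real (num_triples g)"
        by (intro divide_right_mono) auto
      then show "global_clustering g
          \<le> 3 / c * ((real n + 2) / s) * (normalisation (Suc n) g / real (num_triples g))"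
        by (simp add: global_clustering_def mult_ac)
    qed
    also have "\<dots> = 3 / c * ((real n + 2) / s) * mean_inverse n"
      unfolding mean_inverse_def by (rule integral_mult_right_zero)
    finally show "expectation (\<lambda>\<omega>. global_clustering (G (Suc n) \<omega>))
      \<le> 3 / c * (real n + 2) powr (1 - growth_exponent) * mean_inverse n"
      by (simp add: split)
  qed
qed

lemma mean_clustering_le_3: "1 \<le> t \<Longrightarrow> expectation (\<lambda>\<omega>. global_clustering (G t \<omega>)) \<le> 3"
proof -
  assume t: "1 \<le> t"
  have "expectation (\<lambda>\<omega>. global_clustering (G t \<omega>)) \<le> expectation (\<lambda>\<omega>. 3)"
  proof (rule expectation_mono[of t _ "\<lambda>_. 3"])
    fix g assume "reachable t g"
    then show "global_clustering g \<le> 3"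
      using reachable_counts[of t g] t by (simp add: global_clustering_def pos_divide_le_eq)
  qed
  then show ?thesis by (simp add: prob_space)
qed

lemma theta_subcritical:
  assumes "0 < growth_exponent" "growth_exponent < 1"
  shows "(\<lambda>t. expectation (\<lambda>\<omega>. global_clustering (G t \<omega>))) \<in> \<Theta>(\<lambda>t. 1)"
proof -
  let ?p = growth_exponent
  obtain K where K: "0 < K"
    and C: "\<And>t. expectation (\<lambda>\<omega>. real (num_triples (G t \<omega>)))
      \<le> K * (real t + 1) powr ?p * (\<Sum>s<t. (real s + 1) powr (- ?p))"
    using mean_triples_upper by blast
  define L where "L = K * 2 powr ?p / (1 - ?p)"
  have L: "0 < L" using K assms by (simp add: L_def)
  show ?thesis
  proof (rule bigtheta_sandwich)
    show "0 < 3 * \<alpha>\<^sup>2 / L" using L alpha_pos by simp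
    show "eventually (\<lambda>t. 3 * \<alpha>\<^sup>2 / L * 1 \<le> expectation (\<lambda>\<omega>. global_clustering (G t \<omega>))) sequentially"
      using eventually_ge_at_top[of 1]
    proof eventually_elim
      case (elim t)
      define m where "m = expectation (\<lambda>\<omega>. real (num_triples (G t \<omega>)))"
      have "m \<le> K * (real t + 1) powr ?p * (real t powr (1 - ?p) / (1 - ?p))"
        unfolding m_def using C[of t] mult_left_mono[OF sum_powr_subcritical[OF assms, of t],
            of "K * (real t + 1) powr ?p"] K by simp
      also have "\<dots> \<le> K * (2 * real t) powr ?p * (real t powr (1 - ?p) / (1 - ?p))"
        using K assms elim by (intro mult_left_mono mult_right_mono powr_mono2) auto
      also have "\<dots> = L * (real t powr ?p * real t powr (1 - ?p))"
        by (simp add: L_def powr_mult)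
      also have "real t powr ?p * real t powr (1 - ?p) = real t"
        using elim by (simp flip: powr_add)
      finally have "m \<le> L * real t" .
      from mean_clustering_lower[OF elim this[unfolded m_def]] show ?case using elim by simp
    qed
    show "eventually (\<lambda>t. expectation (\<lambda>\<omega>. global_clustering (G t \<omega>)) \<le> 3 * 1) sequentially"
      using eventually_ge_at_top[of 1] by eventually_elim (simp add: mean_clustering_le_3)
  qed simp
qed

text \<open>Lower bound: the mean number of triples is at most of order \<open>t\<close> times a harmonic sum. Upper bound: the
  recursion for \<open>mean_inverse\<close> is of logistic type, and its solution decays like an inverse harmonic
  sum.\<close>

lemma theta_critical:
  assumes p: "growth_exponent = 1"
  shows "(\<lambda>t. expectation (\<lambda>\<omega>. global_clustering (G t \<omega>))) \<in> \<Theta>(\<lambda>t. inverse (ln (real t)))"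
proof -
  obtain K where K: "0 < K"
    and C: "\<And>t. expectation (\<lambda>\<omega>. real (num_triples (G t \<omega>)))
      \<le> K * (real t + 1) powr growth_exponent * (\<Sum>s<t. (real s + 1) powr (- growth_exponent))"
    using mean_triples_upper by blast
  obtain L c where L: "0 \<le> L" and c: "0 < c"
    and rec: "\<And>n. mean_inverse (Suc n) \<le> mean_inverse n * (1 + L * (real n + 1) powr (- (3/2)))
        - c * (real n + 2) powr (- growth_exponent) * (mean_inverse n)\<^sup>2"
    using mean_inverse_recursion by blast
  obtain D where D: "0 < D"
    and up: "\<And>n. expectation (\<lambda>\<omega>. global_clustering (G (Suc n) \<omega>)) 
      \<le> D * (real n + 2) powr (1 - growth_exponent) * mean_inverse n"
    using mean_clustering_upper by blast
  obtain B where B: "\<And>n. (\<Sum>k<n. (real k + 1) powr (- (3/2))) \<le> B"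
    using sum_powr_supercritical[of "3/2"] by auto
  have bound: "mean_inverse n * harm n \<le> exp (2 * (L * B)) / (c / 2)" for n
  proof (rule logistic_recursion_bound)
    fix n
    have "c / 2 / (real n + 1) \<le> c * (real n + 2) powr (- 1)"
      using c by (simp add: powr_minus_divide field_simps)
    then have "c / 2 / (real n + 1) * (mean_inverse n)\<^sup>2 \<le> c * (real n + 2) powr (- 1) * (mean_inverse n)\<^sup>2"
      by (rule mult_right_mono) simp
    then show "mean_inverse (Suc n) \<le> mean_inverse n * (1 + L * (real n + 1) powr (- (3/2)))
        - c / 2 / (real n + 1) * (mean_inverse n)\<^sup>2"
      using rec[of n] by (simp add: p)
    show "(\<Sum>k<n. L * (real k + 1) powr (- (3/2))) \<le> L * B"
      using mult_left_mono[OF B L] by (simp add: sum_distrib_left)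
  qed (use L c mean_inverse_pos in auto)
  define U where "U = D * (exp (2 * (L * B)) / (c / 2))"
  show ?thesis
  proof (rule bigtheta_sandwich)
    show "0 < 3 * \<alpha>\<^sup>2 / (4 * K)" using K alpha_pos by simp
    show "eventually (\<lambda>t. 0 \<le> inverse (ln (real t))) sequentially"
      using eventually_ge_at_top[of 1] by eventually_elim simp
    show "eventually (\<lambda>t. 3 * \<alpha>\<^sup>2 / (4 * K) * inverse (ln (real t))
        \<le> expectation (\<lambda>\<omega>. global_clustering (G t \<omega>))) sequentially"
      using eventually_ge_at_top[of 3]
    proof eventually_elim
      case (elim t)
      have "exp 1 \<le> real t" using exp_le elim by linarith
      then have ln: "1 \<le> ln (real t)" using elim by (subst ln_ge_iff) auto
      have t: "1 \<le> t" using elim by simp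
      have "K * (real t + 1) * harm t \<le> K * (2 * real t) * (2 * ln (real t))"
        using K harm_le_ln[OF t] ln t by (intro mult_mono) (auto simp: harm_nonneg)
      then have "expectation (\<lambda>\<omega>. real (num_triples (G t \<omega>))) \<le> K * (2 * real t) * (2 * ln (real t))"
        using C[of t] unfolding p sum_powr_critical by simp
      from mean_clustering_lower[OF t this] show ?case
        using t by (simp add: field_simps)
    qed
    show "eventually (\<lambda>t. expectation (\<lambda>\<omega>. global_clustering (G t \<omega>))
        \<le> U * inverse (ln (real t))) sequentially"
      using eventually_ge_at_top[of 2]
    proof eventually_elim
      case (elim t)
      then obtain n where n: "t = Suc n" by (cases t) auto
      have "0 < ln (real t)" using elim by simp
      moreover have "ln (real t) \<le> harm n" using ln_le_harm[of n] by (simp add: n add.commute)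
      ultimately have "mean_inverse n * ln (real t) \<le> exp (2 * (L * B)) / (c / 2)"
        using bound[of n] mult_left_mono[of "ln (real t)" "harm n" "mean_inverse n"]
          mean_inverse_pos[of n] by linarith
      then have "D * (mean_inverse n * ln (real t)) \<le> U"
        unfolding U_def using D by (intro mult_left_mono) auto
      then have "D * mean_inverse n \<le> U * inverse (ln (real t))"
        using \<open>0 < ln (real t)\<close> by (simp add: field_simps)
      then show ?case using up[of n] by (simp add: n p)
    qed
  qed
qed

text \<open>The negative term of the recursion for \<open>mean_inverse\<close> can be dropped: boundedness is enough here.\<close>

lemma theta_supercritical:
  assumes p: "1 < growth_exponent"
  shows "(\<lambda>t. expectation (\<lambda>\<omega>. global_clustering (G t \<omega>))) \<in> \<Theta>(\<lambda>t. real t powr (1 - growth_exponent))"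
proof -
  let ?p = growth_exponent
  obtain K where K: "0 < K"
    and C: "\<And>t. expectation (\<lambda>\<omega>. real (num_triples (G t \<omega>)))
      \<le> K * (real t + 1) powr ?p * (\<Sum>s<t. (real s + 1) powr (- ?p))"
    using mean_triples_upper by blast
  obtain S where S: "0 \<le> S" "\<And>t. (\<Sum>s<t. (real s + 1) powr (- ?p)) \<le> S"
    using sum_powr_supercritical[OF p] by blast
  obtain L c where L: "0 \<le> L" and c: "0 < c"
    and rec: "\<And>n. mean_inverse (Suc n) \<le> mean_inverse n * (1 + L * (real n + 1) powr (- (3/2)))
        - c * (real n + 2) powr (- ?p) * (mean_inverse n)\<^sup>2"
    using mean_inverse_recursion by blast
  obtain D where D: "0 < D"
    and up: "\<And>n. expectation (\<lambda>\<omega>. global_clustering (G (Suc n) \<omega>))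
      \<le> D * (real n + 2) powr (1 - ?p) * mean_inverse n"
    using mean_clustering_upper by blast
  obtain B where B: "\<And>n. (\<Sum>k<n. (real k + 1) powr (- (3/2))) \<le> B"
    using sum_powr_supercritical[of "3/2"] by auto
  have bound: "mean_inverse n \<le> exp (L * B) * mean_inverse 0" for n
  proof -
    have "mean_inverse (Suc n) \<le> mean_inverse n * (1 + L * (real n + 1) powr (- (3/2))) + 0" for n
      using rec[of n] c by (smt (verit) mult_nonneg_nonneg powr_ge_zero zero_le_power2)
    then have "mean_inverse n \<le> exp (\<Sum>k<n. L * (real k + 1) powr (- (3/2))) * (mean_inverse 0 + (\<Sum>k<n. 0))"
      by (rule recursion_bound) (use L mean_inverse_pos[of 0] in auto)
    also have "\<dots> \<le> exp (L * B) * mean_inverse 0"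
      using mult_left_mono[OF B L] mean_inverse_pos[of 0]
      by (intro mult_mono) (auto simp: sum_distrib_left[symmetric])
    finally show ?thesis .
  qed
  define H where "H = K * 2 powr ?p * (S + 1)"
  have H: "0 < H" using K S by (simp add: H_def)
  show ?thesis
  proof (rule bigtheta_sandwich)
    show "0 < 3 * \<alpha>\<^sup>2 / H" using H alpha_pos by simp
    show "eventually (\<lambda>t. 3 * \<alpha>\<^sup>2 / H * real t powr (1 - ?p)
        \<le> expectation (\<lambda>\<omega>. global_clustering (G t \<omega>))) sequentially"
      using eventually_ge_at_top[of 1]
    proof eventually_elim
      case (elim t)
      have "K * (real t + 1) powr ?p * (\<Sum>s<t. (real s + 1) powr (- ?p))
          \<le> K * (2 * real t) powr ?p * (S + 1)"
        using K S(2)[of t] p elim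
        by (intro mult_mono mult_left_mono powr_mono2) (auto intro!: sum_nonneg)
      then have "expectation (\<lambda>\<omega>. real (num_triples (G t \<omega>))) \<le> H * real t powr ?p"
        using C[of t] by (simp add: H_def powr_mult mult_ac)
      from mean_clustering_lower[OF elim this] show ?case
        using elim by (simp add: powr_diff)
    qed
    show "eventually (\<lambda>t. expectation (\<lambda>\<omega>. global_clustering (G t \<omega>))
        \<le> D * (exp (L * B) * mean_inverse 0) * real t powr (1 - ?p)) sequentially"
      using eventually_ge_at_top[of 1]
    proof eventually_elim
      case (elim t)
      then obtain n where n: "t = Suc n" by (cases t) auto
      have "D * (real n + 2) powr (1 - ?p) * mean_inverse n
          \<le> D * real t powr (1 - ?p) * (exp (L * B) * mean_inverse 0)"
        using D p bound[of n] mean_inverse_pos[of n]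
        by (intro mult_mono mult_left_mono powr_mono2') (auto simp: n)
      then show ?case using up[of n] by (simp add: n mult_ac)
    qed
  qed simp
qed

end

theorem theorem3p3:
  fixes M :: "'a measure" and G :: "nat \<Rightarrow> 'a \<Rightarrow> graph" and \<alpha> \<delta> A :: real
  assumes "0 < \<alpha>" and "\<alpha> \<le> 1" and "-1 < \<delta>"
    and "random_graph_process M G \<alpha> \<delta>"
    and "A = ((\<alpha> + 1)\<^sup>2 + \<delta> * \<alpha>) / ((\<alpha> + 1) * (2 * (\<alpha> + 1) + \<delta>))"
  shows "(A < 1/2 \<longrightarrow>
            (\<lambda>t. prob_space.expectation M (\<lambda>\<omega>. global_clustering (G t \<omega>))) \<in> \<Theta>(\<lambda>t. 1)) \<and>
         (A = 1/2 \<longrightarrow>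
            (\<lambda>t. prob_space.expectation M (\<lambda>\<omega>. global_clustering (G t \<omega>)))
              \<in> \<Theta>(\<lambda>t. inverse (ln (real t)))) \<and>
         (A > 1/2 \<longrightarrow>
            (\<lambda>t. prob_space.expectation M (\<lambda>\<omega>. global_clustering (G t \<omega>)))
              \<in> \<Theta>(\<lambda>t. real t powr (1 - 2 * A)))"
proof -
  interpret clustering_process M G \<alpha> \<delta>
    using assms by (simp add: clustering_process_def attachment_parameters_def)
  have pos: "0 < \<alpha> + 1" "0 < 2 * (\<alpha> + 1) + \<delta>" using assms(1,3) by auto
  have "growth_exponent = 2 * A"
    using pos unfolding assms(5) growth_exponent_def edge_exponent_def weight_exponent_def
    by (simp add: add.commute[of 1] divide_simps) (simp add: algebra_simps power2_eq_square)
  moreover have "0 < A"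
  proof -
    have "(- 1) * \<alpha> \<le> \<delta> * \<alpha>" using assms by (intro mult_right_mono) auto
    then have "0 < (\<alpha> + 1)\<^sup>2 + \<delta> * \<alpha>"
    proof -
      have "(\<alpha> + 1)\<^sup>2 + \<delta> * \<alpha> = 1 + 2 * \<alpha> + \<alpha> * \<alpha> + \<delta> * \<alpha>"
        by (simp add: power2_eq_square algebra_simps)
      moreover have "0 \<le> \<alpha> * \<alpha>" by simp
      ultimately show ?thesis using \<open>(- 1) * \<alpha> \<le> \<delta> * \<alpha>\<close> assms(1) by linarith
    qed
    then show ?thesis unfolding assms(5) using pos by simp
  qed
  ultimately show ?thesis
    using theta_subcritical theta_critical theta_supercritical by simp
qed

end
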